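(* Suppose that $\mathcal{C}$ is a triangulated category that has a finite collection of generators. Then the minimum number of generators of $\mathcal{C}$ is $\max\{g(K_0(\mathcal{C})), 1\}$.
   Context: A (nonempty) collection of objects of a triangulated category $\mathcal{C}$ generates $\mathcal{C}$ if its triangulated closure, i.e. the smallest full triangulated subcategory (closed under isomorphism, shifts and cones) containing the collection, equals $\mathcal{C}$; no passage to direct summands is allowed. $K_0(\mathcal{C})$ is the Grothendieck group: the free abelian group on isomorphism classes of objects modulo $[B]=[A]+[C]$ for every exact triangle $A\to B\to C\to A[1]$. For an abelian group $A$, $g(A)$ denotes the minimum number of generators of $A$ as a $\mathbb{Z}$-module. *)

theory Defs
  imports
    "HOL-Algebra.Free_Abelian_Groups"
    "HOL-Algebra.Generated_Groups"
    "HOL-Library.Extended_Nat"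
begin

section \<open>Categories\<close>

text \<open>
  Categories are given by carriers of objects and arrows; every arrow carries its domain and
  codomain, so hom-sets between different pairs of objects are disjoint.  As in
  \<^theory>\<open>HOL-Algebra.Group\<close>, the operations are only meaningful on the carriers.
\<close>

record ('o, 'm) category =
  Obj :: "'o set"
  Arr :: "'m set"
  Dom :: "'m \<Rightarrow> 'o"
  Cod :: "'m \<Rightarrow> 'o"
  Ident :: "'o \<Rightarrow> 'm"
  Comp :: "'m \<Rightarrow> 'm \<Rightarrow> 'm"  (infixl "\<cdot>\<index>" 70)

definition Hom :: "('o, 'm, 'x) category_scheme \<Rightarrow> 'o \<Rightarrow> 'o \<Rightarrow> 'm set" where
  "Hom C X Y = {f \<in> Arr C. Dom C f = X \<and> Cod C f = Y}"

locale category =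
  fixes C (structure)
  assumes Dom_closed: "f \<in> Arr C \<Longrightarrow> Dom C f \<in> Obj C"
    and Cod_closed: "f \<in> Arr C \<Longrightarrow> Cod C f \<in> Obj C"
    and Ident_closed: "X \<in> Obj C \<Longrightarrow> Ident C X \<in> Hom C X X"
    and Comp_closed: "\<lbrakk>f \<in> Hom C X Y; g \<in> Hom C Y Z\<rbrakk> \<Longrightarrow> g \<cdot> f \<in> Hom C X Z"
    and Comp_Ident: "f \<in> Hom C X Y \<Longrightarrow> f \<cdot> Ident C X = f"
    and Ident_Comp: "f \<in> Hom C X Y \<Longrightarrow> Ident C Y \<cdot> f = f"
    and Comp_assoc: "\<lbrakk>f \<in> Hom C W X; g \<in> Hom C X Y; h \<in> Hom C Y Z\<rbrakk>
          \<Longrightarrow> (h \<cdot> g) \<cdot> f = h \<cdot> (g \<cdot> f)"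

definition is_iso :: "('o, 'm, 'x) category_scheme \<Rightarrow> 'o \<Rightarrow> 'o \<Rightarrow> 'm \<Rightarrow> bool" where
  "is_iso C X Y f \<longleftrightarrow> f \<in> Hom C X Y \<and>
     (\<exists>g \<in> Hom C Y X. g \<cdot>\<^bsub>C\<^esub> f = Ident C X \<and> f \<cdot>\<^bsub>C\<^esub> g = Ident C Y)"

definition isomorphic :: "('o, 'm, 'x) category_scheme \<Rightarrow> 'o \<Rightarrow> 'o \<Rightarrow> bool" where
  "isomorphic C X Y \<longleftrightarrow> (\<exists>f. is_iso C X Y f)"

definition zero_object :: "('o, 'm, 'x) category_scheme \<Rightarrow> 'o \<Rightarrow> bool" where
  "zero_object C Z \<longleftrightarrow> Z \<in> Obj C \<and>
     (\<forall>X \<in> Obj C. (\<exists>!f. f \<in> Hom C X Z) \<and> (\<exists>!f. f \<in> Hom C Z X))"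


section \<open>Additive categories\<close>

record ('o, 'm) preadditive_category = "('o, 'm) category" +
  Add :: "'m \<Rightarrow> 'm \<Rightarrow> 'm"  (infixl "\<boxplus>\<index>" 65)
  Zero :: "'o \<Rightarrow> 'o \<Rightarrow> 'm"

definition Hom_group ::
    "('o, 'm, 'x) preadditive_category_scheme \<Rightarrow> 'o \<Rightarrow> 'o \<Rightarrow> 'm monoid" where
  "Hom_group C X Y = \<lparr>carrier = Hom C X Y, monoid.mult = Add C, one = Zero C X Y\<rparr>"

definition Neg :: "('o, 'm, 'x) preadditive_category_scheme \<Rightarrow> 'm \<Rightarrow> 'm" where
  "Neg C f = inv\<^bsub>Hom_group C (Dom C f) (Cod C f)\<^esub> f"

locale preadditive_category = category C for C (structure) +
  assumes Hom_comm_group: "\<lbrakk>X \<in> Obj C; Y \<in> Obj C\<rbrakk> \<Longrightarrow> comm_group (Hom_group C X Y)"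
    and Comp_Add_left: "\<lbrakk>f \<in> Hom C X Y; g \<in> Hom C Y Z; g' \<in> Hom C Y Z\<rbrakk>
          \<Longrightarrow> (g \<boxplus> g') \<cdot> f = (g \<cdot> f) \<boxplus> (g' \<cdot> f)"
    and Comp_Add_right: "\<lbrakk>f \<in> Hom C X Y; f' \<in> Hom C X Y; g \<in> Hom C Y Z\<rbrakk>
          \<Longrightarrow> g \<cdot> (f \<boxplus> f') = (g \<cdot> f) \<boxplus> (g \<cdot> f')"

locale additive_category = preadditive_category C for C (structure) +
  assumes ex_zero_object: "\<exists>Z. zero_object C Z"
    and ex_biproduct: "\<lbrakk>X \<in> Obj C; Y \<in> Obj C\<rbrakk> \<Longrightarrow>
          \<exists>P \<in> Obj C. \<exists>i \<in> Hom C X P. \<exists>j \<in> Hom C Y P. \<exists>p \<in> Hom C P X. \<exists>q \<in> Hom C P Y.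
            p \<cdot> i = Ident C X \<and> q \<cdot> j = Ident C Y \<and>
            q \<cdot> i = Zero C X Y \<and> p \<cdot> j = Zero C Y X \<and>
            (i \<cdot> p) \<boxplus> (j \<cdot> q) = Ident C P"


section \<open>Triangulated categories\<close>

text \<open>
  A triangle \<open>X \<rightarrow> Y \<rightarrow> Z \<rightarrow> X[1]\<close> is encoded by its three arrows \<open>(f, g, h)\<close>, from which the
  objects can be read off.
\<close>

record ('o, 'm) triangulated_category = "('o, 'm) preadditive_category" +
  Shift :: "'o \<Rightarrow> 'o"
  Shift_arr :: "'m \<Rightarrow> 'm"
  Exact :: "('m \<times> 'm \<times> 'm) set"

definition triangle ::
    "('o, 'm, 'x) triangulated_category_scheme \<Rightarrow> 'm \<Rightarrow> 'm \<Rightarrow> 'm \<Rightarrow> bool" where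
  "triangle C f g h \<longleftrightarrow> f \<in> Arr C \<and> g \<in> Arr C \<and> h \<in> Arr C \<and>
     Cod C f = Dom C g \<and> Cod C g = Dom C h \<and> Cod C h = Shift C (Dom C f)"

text \<open>
  The shift is only required to be an additive auto-equivalence; the case where it is an
  automorphism of the category is included.
\<close>

locale additive_category_with_shift = additive_category C for C (structure) +
  assumes Shift_closed: "X \<in> Obj C \<Longrightarrow> Shift C X \<in> Obj C"
    and Shift_arr_closed: "f \<in> Hom C X Y \<Longrightarrow> Shift_arr C f \<in> Hom C (Shift C X) (Shift C Y)"
    and Shift_Ident: "X \<in> Obj C \<Longrightarrow> Shift_arr C (Ident C X) = Ident C (Shift C X)"
    and Shift_Comp: "\<lbrakk>f \<in> Hom C X Y; g \<in> Hom C Y Z\<rbrakk>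
          \<Longrightarrow> Shift_arr C (g \<cdot> f) = Shift_arr C g \<cdot> Shift_arr C f"
    and Shift_Add: "\<lbrakk>f \<in> Hom C X Y; f' \<in> Hom C X Y\<rbrakk>
          \<Longrightarrow> Shift_arr C (f \<boxplus> f') = Shift_arr C f \<boxplus> Shift_arr C f'"
    and Shift_fully_faithful: "\<lbrakk>X \<in> Obj C; Y \<in> Obj C\<rbrakk>
          \<Longrightarrow> bij_betw (Shift_arr C) (Hom C X Y) (Hom C (Shift C X) (Shift C Y))"
    and Shift_ess_surj: "Y \<in> Obj C \<Longrightarrow> \<exists>X \<in> Obj C. isomorphic C (Shift C X) Y"

locale triangulated_category = additive_category_with_shift C for C (structure) +
  assumes Exact_triangle: "(f, g, h) \<in> Exact C \<Longrightarrow> triangle C f g h"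
    and TR1_iso: "\<lbrakk>(f, g, h) \<in> Exact C; triangle C f' g' h';
            is_iso C (Dom C f) (Dom C f') a; is_iso C (Dom C g) (Dom C g') b;
            is_iso C (Dom C h) (Dom C h') c;
            b \<cdot> f = f' \<cdot> a; c \<cdot> g = g' \<cdot> b; Shift_arr C a \<cdot> h = h' \<cdot> c\<rbrakk>
          \<Longrightarrow> (f', g', h') \<in> Exact C"
    and TR1_Ident: "\<lbrakk>X \<in> Obj C; zero_object C Z\<rbrakk>
          \<Longrightarrow> (Ident C X, Zero C X Z, Zero C Z (Shift C X)) \<in> Exact C"
    and TR1_cone: "f \<in> Arr C \<Longrightarrow> \<exists>g h. (f, g, h) \<in> Exact C"
    and TR2: "triangle C f g h
          \<Longrightarrow> (f, g, h) \<in> Exact C \<longleftrightarrow> (g, h, Neg C (Shift_arr C f)) \<in> Exact C"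
    and TR3: "\<lbrakk>(f, g, h) \<in> Exact C; (f', g', h') \<in> Exact C;
            a \<in> Hom C (Dom C f) (Dom C f'); b \<in> Hom C (Dom C g) (Dom C g');
            b \<cdot> f = f' \<cdot> a\<rbrakk>
          \<Longrightarrow> \<exists>c \<in> Hom C (Dom C h) (Dom C h').
                c \<cdot> g = g' \<cdot> b \<and> Shift_arr C a \<cdot> h = h' \<cdot> c"
    \<comment> \<open>With \<open>f : X \<rightarrow> Y\<close>, \<open>g : Y \<rightarrow> Z\<close> and cones \<open>U\<close>, \<open>V\<close>, \<open>W\<close> of \<open>f\<close>, \<open>g\<close>, \<open>g \<cdot> f\<close>,
        the octahedral axiom gives an exact triangle \<open>U \<rightarrow> W \<rightarrow> V \<rightarrow> U[1]\<close>.\<close>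
    and TR4: "\<lbrakk>f \<in> Hom C X Y; g \<in> Hom C Y Z;
            (f, i, j) \<in> Exact C; (g, k, l) \<in> Exact C; (g \<cdot> f, m, n) \<in> Exact C\<rbrakk>
          \<Longrightarrow> \<exists>u \<in> Hom C (Cod C i) (Cod C m). \<exists>v \<in> Hom C (Cod C m) (Cod C k).
                (u, v, Shift_arr C i \<cdot> l) \<in> Exact C \<and>
                u \<cdot> i = m \<cdot> g \<and> n \<cdot> u = j \<and> v \<cdot> m = k \<and> l \<cdot> v = Shift_arr C f \<cdot> n"


section \<open>Generators of a triangulated category\<close>

text \<open>
  Full triangulated subcategories are identified with their sets of objects.  Closure under
  both positive and negative shifts is the equivalence \<open>X \<in> S \<longleftrightarrow> X[1] \<in> S\<close>: as \<open>S\<close> is closed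
  under isomorphism and the shift is essentially surjective, \<open>X[1] \<in> S \<Longrightarrow> X \<in> S\<close> is closure
  under \<open>[-1]\<close>.
\<close>

definition triangulated_subcategory ::
    "('o, 'm, 'x) triangulated_category_scheme \<Rightarrow> 'o set \<Rightarrow> bool" where
  "triangulated_subcategory C S \<longleftrightarrow> S \<subseteq> Obj C \<and> S \<noteq> {} \<and>
     (\<forall>X \<in> S. \<forall>Y \<in> Obj C. isomorphic C X Y \<longrightarrow> Y \<in> S) \<and>
     (\<forall>X \<in> Obj C. X \<in> S \<longleftrightarrow> Shift C X \<in> S) \<and>
     (\<forall>f g h. (f, g, h) \<in> Exact C \<longrightarrow> Dom C f \<in> S \<longrightarrow> Cod C f \<in> S \<longrightarrow> Cod C g \<in> S)"

definition triangulated_closure ::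
    "('o, 'm, 'x) triangulated_category_scheme \<Rightarrow> 'o set \<Rightarrow> 'o set" where
  "triangulated_closure C G = \<Inter> {S. triangulated_subcategory C S \<and> G \<subseteq> S}"

definition generates :: "('o, 'm, 'x) triangulated_category_scheme \<Rightarrow> 'o set \<Rightarrow> bool" where
  "generates C G \<longleftrightarrow> G \<noteq> {} \<and> G \<subseteq> Obj C \<and> triangulated_closure C G = Obj C"

text \<open>The minimum is \<open>\<infinity>\<close> if there is no finite collection of generators.\<close>

definition min_generators :: "('o, 'm, 'x) triangulated_category_scheme \<Rightarrow> enat" where
  "min_generators C = (INF G \<in> {G. finite G \<and> generates C G}. enat (card G))"


section \<open>The Grothendieck group\<close>

definition iso_class :: "('o, 'm, 'x) category_scheme \<Rightarrow> 'o \<Rightarrow> 'o set" where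
  "iso_class C X = {Y \<in> Obj C. isomorphic C X Y}"

definition K0_free ::
    "('o, 'm, 'x) triangulated_category_scheme \<Rightarrow> ('o set \<Rightarrow>\<^sub>0 int) monoid" where
  "K0_free C = free_Abelian_group (iso_class C ` Obj C)"

definition K0_relations ::
    "('o, 'm, 'x) triangulated_category_scheme \<Rightarrow> ('o set \<Rightarrow>\<^sub>0 int) set" where
  "K0_relations C =
     {frag_of (iso_class C (Cod C f)) -
        (frag_of (iso_class C (Dom C f)) + frag_of (iso_class C (Cod C g))) | f g h.
      (f, g, h) \<in> Exact C}"

definition K0 ::
    "('o, 'm, 'x) triangulated_category_scheme \<Rightarrow> ('o set \<Rightarrow>\<^sub>0 int) set monoid" where
  "K0 C = K0_free C Mod generate (K0_free C) (K0_relations C)"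

text \<open>
  The minimum number of generators of a group, \<open>\<infinity>\<close> if it is not finitely generated.  For an
  abelian group, the subgroup generated by a set is its \<open>\<int>\<close>-linear span.
\<close>

definition min_group_generators :: "('a, 'x) monoid_scheme \<Rightarrow> enat" where
  "min_group_generators A =
     (INF S \<in> {S. finite S \<and> S \<subseteq> carrier A \<and> generate A S = carrier A}. enat (card S))"

end

theory Submission
  imports Defs
begin

text \<open>
  One inequality is formal.  For a subgroup of the Grothendieck group, the objects whose class lies
  in it form a triangulated subcategory; so the classes of any generating collection of objects
  generate the group (\<open>generators_generate_K0\<close>).

  The other inequality rests on Thomason's theorem: a triangulated subcategory \<open>S\<close> that is dense,
  i.e. such that every object is a direct summand of an object of \<open>S\<close>, is determined by the
  subgroup of classes of its objects.  The case needed is that \<open>S\<close> is everything if these classes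
  generate the group (\<open>dense_eq_Obj_if_generates_K0\<close>).  Its proof considers the objects up to
  isomorphism and up to adding objects of \<open>S\<close>.  Density makes this quotient a group under direct
  sum; passing to the quotient is additive on exact triangles, hence factors through the
  Grothendieck group; and the objects that become zero are exactly those of \<open>S\<close>.

  Now let a nonempty set of generators of the Grothendieck group be given.  Each of them is the
  class of an object, as negatives are realised by shifts (\<open>K0_carrier_eq\<close>).  Let \<open>B\<close> be the
  direct sum of a finite collection of generators of the category and add \<open>B \<oplus> B[1]\<close>, which has
  class zero, to each of these objects.  The triangulated closure of the resulting objects contains
  every original generator up to a summand.  As the summands of objects of a triangulated
  subcategory form a triangulated subcategory again (\<open>summands_triangulated\<close>), it is dense, and
  Thomason's theorem applies (\<open>K0_generators_lift\<close>).

  Both uses of summands require that direct sums of exact triangles are exact (\<open>exact_sum\<close>), which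
  is derived from the axioms by means of the exactness of the functors \<open>Hom(T, _)\<close> and the five
  lemma.
\<close>

section \<open>Arrow calculus\<close>

text \<open>
  The axioms are stated for arrows in given hom-sets \<open>Hom C X Y\<close>; as rewrite rules they would
  have conditions with undetermined \<open>X\<close> and \<open>Y\<close>.  Restated with \<open>Dom\<close> and \<open>Cod\<close>, every
  typing condition of a compound arrow can be computed by the simplifier.  Composites are kept
  nested to the right.
\<close>

context category
begin

lemma comp_simps [simp]:
  assumes "f \<in> Arr C" "g \<in> Arr C" "Cod C f = Dom C g"
  shows "g \<cdot> f \<in> Arr C" "Dom C (g \<cdot> f) = Dom C f" "Cod C (g \<cdot> f) = Cod C g"
  using Comp_closed[of f "Dom C f" "Dom C g" g "Cod C g"] assms by (auto simp: Hom_def)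

lemma ident_simps [simp]:
  assumes "X \<in> Obj C"
  shows "Ident C X \<in> Arr C" "Dom C (Ident C X) = X" "Cod C (Ident C X) = X"
  using Ident_closed[OF assms] by (auto simp: Hom_def)

lemmas dom_cod_closed [simp] = Dom_closed Cod_closed

lemma comp_ident [simp]: "\<lbrakk>f \<in> Arr C; Dom C f = X\<rbrakk> \<Longrightarrow> f \<cdot> Ident C X = f"
  using Comp_Ident[of f X "Cod C f"] by (auto simp: Hom_def)

lemma ident_comp [simp]: "\<lbrakk>f \<in> Arr C; Cod C f = Y\<rbrakk> \<Longrightarrow> Ident C Y \<cdot> f = f"
  using Ident_Comp[of f "Dom C f" Y] by (auto simp: Hom_def)

lemma comp_assoc:
  "\<lbrakk>f \<in> Arr C; g \<in> Arr C; h \<in> Arr C; Cod C f = Dom C g; Cod C g = Dom C h\<rbrakk>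
   \<Longrightarrow> (h \<cdot> g) \<cdot> f = h \<cdot> (g \<cdot> f)"
  by (rule Comp_assoc[of f "Dom C f" "Dom C g" g "Dom C h" h "Cod C h"]) (auto simp: Hom_def)

text \<open>
  In a composite nested to the right, a known value of \<open>h \<cdot> g\<close> is not visible as a subterm when
  a further arrow is composed on the right; this form rewrites it there.
\<close>

lemma comp_comp_eq:
  assumes "h \<cdot> g = k" "f \<in> Arr C" "g \<in> Arr C" "h \<in> Arr C" "Cod C f = Dom C g" "Cod C g = Dom C h"
  shows "h \<cdot> (g \<cdot> f) = k \<cdot> f"
  using comp_assoc[of f g h] assms by simp

lemma isomorphicI:
  assumes "f \<in> Arr C" "g \<in> Arr C" "Dom C f = X" "Cod C f = Y" "Dom C g = Y" "Cod C g = X"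
    "g \<cdot> f = Ident C X" "f \<cdot> g = Ident C Y"
  shows "isomorphic C X Y"
  using assms unfolding isomorphic_def is_iso_def Hom_def by blast

lemma isomorphicE:
  assumes "isomorphic C X Y"
  obtains f g where "f \<in> Arr C" "g \<in> Arr C" "Dom C f = X" "Cod C f = Y" "Dom C g = Y" "Cod C g = X"
    "g \<cdot> f = Ident C X" "f \<cdot> g = Ident C Y" "X \<in> Obj C" "Y \<in> Obj C"
  using assms unfolding isomorphic_def is_iso_def Hom_def by (auto dest: Dom_closed Cod_closed)

lemma isomorphic_obj: "isomorphic C X Y \<Longrightarrow> X \<in> Obj C \<and> Y \<in> Obj C"
  by (auto elim: isomorphicE)

lemma isomorphic_refl: "X \<in> Obj C \<Longrightarrow> isomorphic C X X"
  by (rule isomorphicI[of "Ident C X" "Ident C X"]) auto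

lemma isomorphic_sym: "isomorphic C X Y \<Longrightarrow> isomorphic C Y X"
  unfolding isomorphic_def is_iso_def by blast

lemma isomorphic_trans [trans]:
  assumes "isomorphic C X Y" "isomorphic C Y Z"
  shows "isomorphic C X Z"
proof -
  obtain f g where f: "f \<in> Arr C" "g \<in> Arr C" "Dom C f = X" "Cod C f = Y" "Dom C g = Y" "Cod C g = X"
    "g \<cdot> f = Ident C X" "f \<cdot> g = Ident C Y" "X \<in> Obj C" "Y \<in> Obj C"
    using assms(1) by (rule isomorphicE)
  obtain h k where h: "h \<in> Arr C" "k \<in> Arr C" "Dom C h = Y" "Cod C h = Z" "Dom C k = Z" "Cod C k = Y"
    "k \<cdot> h = Ident C Y" "h \<cdot> k = Ident C Z" "Z \<in> Obj C"
    using assms(2) by (rule isomorphicE)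
  show ?thesis
    by (rule isomorphicI[of "h \<cdot> f" "g \<cdot> k"])
      (use f h in \<open>simp_all add: comp_assoc comp_comp_eq[OF h(7)] comp_comp_eq[OF f(8)]\<close>)
qed

lemma iso_class_eq: "isomorphic C X Y \<Longrightarrow> iso_class C X = iso_class C Y"
  unfolding iso_class_def by (blast intro: isomorphic_sym isomorphic_trans)

lemma iso_class_eqD:
  "\<lbrakk>iso_class C X = iso_class C Y; Y \<in> Obj C\<rbrakk> \<Longrightarrow> isomorphic C X Y"
  unfolding iso_class_def by (blast intro: isomorphic_refl)

end

context preadditive_category
begin

lemma add_simps [simp]:
  assumes "f \<in> Arr C" "g \<in> Arr C" "Dom C f = Dom C g" "Cod C f = Cod C g"
  shows "f \<boxplus> g \<in> Arr C" "Dom C (f \<boxplus> g) = Dom C g" "Cod C (f \<boxplus> g) = Cod C g"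
proof -
  interpret H: comm_group "Hom_group C (Dom C g) (Cod C g)"
    using assms by (intro Hom_comm_group) auto
  show "f \<boxplus> g \<in> Arr C" "Dom C (f \<boxplus> g) = Dom C g" "Cod C (f \<boxplus> g) = Cod C g"
    using H.m_closed[of f g] assms by (auto simp: Hom_group_def Hom_def)
qed

lemma zero_simps [simp]:
  assumes "X \<in> Obj C" "Y \<in> Obj C"
  shows "Zero C X Y \<in> Arr C" "Dom C (Zero C X Y) = X" "Cod C (Zero C X Y) = Y"
proof -
  interpret H: comm_group "Hom_group C X Y"
    using assms by (intro Hom_comm_group) auto
  show "Zero C X Y \<in> Arr C" "Dom C (Zero C X Y) = X" "Cod C (Zero C X Y) = Y"
    using H.one_closed by (auto simp: Hom_group_def Hom_def)
qed

lemma neg_simps [simp]: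
  assumes "f \<in> Arr C"
  shows "Neg C f \<in> Arr C" "Dom C (Neg C f) = Dom C f" "Cod C (Neg C f) = Cod C f"
    "f \<boxplus> Neg C f = Zero C (Dom C f) (Cod C f)"
proof -
  interpret H: comm_group "Hom_group C (Dom C f) (Cod C f)"
    using assms by (intro Hom_comm_group) auto
  have f: "f \<in> carrier (Hom_group C (Dom C f) (Cod C f))"
    using assms by (auto simp: Hom_group_def Hom_def)
  show "Neg C f \<in> Arr C" "Dom C (Neg C f) = Dom C f" "Cod C (Neg C f) = Cod C f"
    using H.inv_closed[OF f] unfolding Neg_def by (auto simp: Hom_group_def Hom_def)
  show "f \<boxplus> Neg C f = Zero C (Dom C f) (Cod C f)"
    using H.r_inv[OF f] unfolding Neg_def by (auto simp: Hom_group_def)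
qed

lemma add_zero [simp]:
  assumes "f \<in> Arr C" "Dom C f = X" "Cod C f = Y"
  shows "f \<boxplus> Zero C X Y = f" "Zero C X Y \<boxplus> f = f"
proof -
  interpret H: comm_group "Hom_group C X Y"
    using assms by (intro Hom_comm_group) auto
  show "f \<boxplus> Zero C X Y = f" "Zero C X Y \<boxplus> f = f"
    using H.r_one[of f] H.l_one[of f] assms by (auto simp: Hom_group_def Hom_def)
qed

lemma add_comm:
  assumes "f \<in> Arr C" "g \<in> Arr C" "Dom C f = Dom C g" "Cod C f = Cod C g"
  shows "f \<boxplus> g = g \<boxplus> f"
proof -
  interpret H: comm_group "Hom_group C (Dom C g) (Cod C g)"
    using assms by (intro Hom_comm_group) auto
  show ?thesis
    using H.m_comm[of f g] assms by (auto simp: Hom_group_def Hom_def)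
qed

lemma add_assoc:
  assumes "f \<in> Arr C" "g \<in> Arr C" "h \<in> Arr C"
    "Dom C f = Dom C h" "Cod C f = Cod C h" "Dom C g = Dom C h" "Cod C g = Cod C h"
  shows "(f \<boxplus> g) \<boxplus> h = f \<boxplus> (g \<boxplus> h)"
proof -
  interpret H: comm_group "Hom_group C (Dom C h) (Cod C h)"
    using assms by (intro Hom_comm_group) auto
  show ?thesis
    using H.m_assoc[of f g h] assms by (auto simp: Hom_group_def Hom_def)
qed

lemma neg_unique:
  assumes "f \<in> Arr C" "g \<in> Arr C" "Dom C f = Dom C g" "Cod C f = Cod C g"
    "f \<boxplus> g = Zero C (Dom C g) (Cod C g)"
  shows "g = Neg C f" "f = Neg C g"
proof -
  interpret H: comm_group "Hom_group C (Dom C g) (Cod C g)"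
    using assms by (intro Hom_comm_group) auto
  have c: "f \<in> carrier (Hom_group C (Dom C g) (Cod C g))"
    "g \<in> carrier (Hom_group C (Dom C g) (Cod C g))"
    using assms by (auto simp: Hom_group_def Hom_def)
  have 1: "f \<otimes>\<^bsub>Hom_group C (Dom C g) (Cod C g)\<^esub> g = \<one>\<^bsub>Hom_group C (Dom C g) (Cod C g)\<^esub>"
    using assms(5) by (simp add: Hom_group_def)
  show "f = Neg C g"
    unfolding Neg_def using H.inv_equality[OF 1] c by simp
  have 2: "g \<otimes>\<^bsub>Hom_group C (Dom C g) (Cod C g)\<^esub> f = \<one>\<^bsub>Hom_group C (Dom C g) (Cod C g)\<^esub>"
    using 1 H.m_comm c by simp
  show "g = Neg C f"
    unfolding Neg_def using H.inv_equality[OF 2] c assms by simp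
qed

lemma add_cancel:
  assumes "f \<in> Arr C" "g \<in> Arr C" "Dom C f = Dom C g" "Cod C f = Cod C g" "f \<boxplus> g = g"
  shows "f = Zero C (Dom C g) (Cod C g)"
proof -
  interpret H: comm_group "Hom_group C (Dom C g) (Cod C g)"
    using assms by (intro Hom_comm_group) auto
  have c: "f \<in> carrier (Hom_group C (Dom C g) (Cod C g))"
    "g \<in> carrier (Hom_group C (Dom C g) (Cod C g))"
    using assms by (auto simp: Hom_group_def Hom_def)
  have "f = \<one>\<^bsub>Hom_group C (Dom C g) (Cod C g)\<^esub>"
    using H.r_cancel_one[OF c(2) c(1)] assms(5) by (simp add: Hom_group_def)
  then show ?thesis by (simp add: Hom_group_def)
qed

lemma comp_add_left:
  "\<lbrakk>f \<in> Arr C; g \<in> Arr C; g' \<in> Arr C; Cod C f = Dom C g; Dom C g = Dom C g'; Cod C g = Cod C g'\<rbrakk>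
   \<Longrightarrow> (g \<boxplus> g') \<cdot> f = (g \<cdot> f) \<boxplus> (g' \<cdot> f)"
  by (rule Comp_Add_left[of f "Dom C f" "Dom C g" g "Cod C g"]) (auto simp: Hom_def)

lemma comp_add_right:
  "\<lbrakk>f \<in> Arr C; f' \<in> Arr C; g \<in> Arr C; Cod C f = Dom C g; Dom C f = Dom C f'; Cod C f = Cod C f'\<rbrakk>
   \<Longrightarrow> g \<cdot> (f \<boxplus> f') = (g \<cdot> f) \<boxplus> (g \<cdot> f')"
  by (rule Comp_Add_right[of f "Dom C f" "Dom C g" f' g "Cod C g"]) (auto simp: Hom_def)

lemma comp_zero [simp]:
  assumes "g \<in> Arr C" "Dom C g = Y" "X \<in> Obj C"
  shows "g \<cdot> Zero C X Y = Zero C X (Cod C g)"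
proof -
  have Y: "Y \<in> Obj C" using Dom_closed[OF assms(1)] assms(2) by simp
  have "(g \<cdot> Zero C X Y) \<boxplus> (g \<cdot> Zero C X Y) = g \<cdot> Zero C X Y"
    using assms Y comp_add_right[of "Zero C X Y" "Zero C X Y" g, symmetric] by simp
  then show ?thesis
    using add_cancel[of "g \<cdot> Zero C X Y" "g \<cdot> Zero C X Y"] assms Y by simp
qed

lemma zero_comp [simp]:
  assumes "f \<in> Arr C" "Cod C f = Y" "Z \<in> Obj C"
  shows "Zero C Y Z \<cdot> f = Zero C (Dom C f) Z"
proof -
  have Y: "Y \<in> Obj C" using Cod_closed[OF assms(1)] assms(2) by simp
  have "(Zero C Y Z \<cdot> f) \<boxplus> (Zero C Y Z \<cdot> f) = Zero C Y Z \<cdot> f"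
    using assms Y comp_add_left[of f "Zero C Y Z" "Zero C Y Z", symmetric] by simp
  then show ?thesis
    using add_cancel[of "Zero C Y Z \<cdot> f" "Zero C Y Z \<cdot> f"] assms Y by simp
qed

lemma comp_neg [simp]:
  assumes "f \<in> Arr C" "g \<in> Arr C" "Cod C f = Dom C g"
  shows "g \<cdot> Neg C f = Neg C (g \<cdot> f)" "Neg C g \<cdot> f = Neg C (g \<cdot> f)"
proof -
  show "g \<cdot> Neg C f = Neg C (g \<cdot> f)"
    by (rule neg_unique(1)) (use assms in \<open>simp_all flip: comp_add_right\<close>)
  show "Neg C g \<cdot> f = Neg C (g \<cdot> f)"
    by (rule neg_unique(1)) (use assms in \<open>simp_all flip: comp_add_left\<close>)
qed

lemma neg_neg [simp]: "f \<in> Arr C \<Longrightarrow> Neg C (Neg C f) = f"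
  by (rule neg_unique(2)[symmetric]) simp_all

lemma neg_zero [simp]: "\<lbrakk>X \<in> Obj C; Y \<in> Obj C\<rbrakk> \<Longrightarrow> Neg C (Zero C X Y) = Zero C X Y"
  by (rule neg_unique(1)[symmetric]) simp_all

lemma zero_objectD:
  assumes "zero_object C Z"
  shows "Z \<in> Obj C"
    "\<And>f. \<lbrakk>f \<in> Arr C; Cod C f = Z\<rbrakk> \<Longrightarrow> f = Zero C (Dom C f) Z"
    "\<And>f. \<lbrakk>f \<in> Arr C; Dom C f = Z\<rbrakk> \<Longrightarrow> f = Zero C Z (Cod C f)"
proof -
  show Z: "Z \<in> Obj C" using assms by (simp add: zero_object_def)
  show "f = Zero C (Dom C f) Z" if "f \<in> Arr C" "Cod C f = Z" for f
  proof -
    have "\<exists>!f'. f' \<in> Hom C (Dom C f) Z" using assms that by (simp add: zero_object_def)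
    moreover have "f \<in> Hom C (Dom C f) Z" "Zero C (Dom C f) Z \<in> Hom C (Dom C f) Z"
      using that Z by (auto simp: Hom_def)
    ultimately show ?thesis by blast
  qed
  show "f = Zero C Z (Cod C f)" if "f \<in> Arr C" "Dom C f = Z" for f
  proof -
    have "\<exists>!f'. f' \<in> Hom C Z (Cod C f)" using assms that by (simp add: zero_object_def)
    moreover have "f \<in> Hom C Z (Cod C f)" "Zero C Z (Cod C f) \<in> Hom C Z (Cod C f)"
      using that Z by (auto simp: Hom_def)
    ultimately show ?thesis by blast
  qed
qed

lemma zero_objectI:
  assumes Z: "Z \<in> Obj C" and "Ident C Z = Zero C Z Z"
  shows "zero_object C Z"
proof -
  have to_Z: "f = Zero C (Dom C f) Z" if "f \<in> Arr C" "Cod C f = Z" for f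
    using ident_comp[OF that] zero_comp[OF that Z] assms(2) by metis
  have from_Z: "f = Zero C Z (Cod C f)" if "f \<in> Arr C" "Dom C f = Z" for f
    using comp_ident[OF that] comp_zero[OF that Z] assms(2) by metis
  have "\<exists>!f. f \<in> Hom C X Z" if X: "X \<in> Obj C" for X
  proof (rule ex1I)
    show "Zero C X Z \<in> Hom C X Z" using X Z by (simp add: Hom_def)
    show "f = Zero C X Z" if "f \<in> Hom C X Z" for f using that to_Z[of f] by (simp add: Hom_def)
  qed
  moreover have "\<exists>!f. f \<in> Hom C Z X" if X: "X \<in> Obj C" for X
  proof (rule ex1I)
    show "Zero C Z X \<in> Hom C Z X" using X Z by (simp add: Hom_def)
    show "f = Zero C Z X" if "f \<in> Hom C Z X" for f using that from_Z[of f] by (simp add: Hom_def)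
  qed
  ultimately show ?thesis
    unfolding zero_object_def using Z by blast
qed

end

section \<open>Biproducts and Hom-exactness\<close>

context preadditive_category
begin

definition biproduct :: "'a \<Rightarrow> 'a \<Rightarrow> 'a \<Rightarrow> 'b \<Rightarrow> 'b \<Rightarrow> 'b \<Rightarrow> 'b \<Rightarrow> bool" where
  "biproduct P X Y i j p q \<longleftrightarrow>
     P \<in> Obj C \<and> X \<in> Obj C \<and> Y \<in> Obj C \<and>
     i \<in> Hom C X P \<and> j \<in> Hom C Y P \<and> p \<in> Hom C P X \<and> q \<in> Hom C P Y \<and>
     p \<cdot> i = Ident C X \<and> q \<cdot> j = Ident C Y \<and> q \<cdot> i = Zero C X Y \<and> p \<cdot> j = Zero C Y X \<and>
     (i \<cdot> p) \<boxplus> (j \<cdot> q) = Ident C P"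

lemma biproductD:
  assumes "biproduct P X Y i j p q"
  shows "P \<in> Obj C" "X \<in> Obj C" "Y \<in> Obj C" "i \<in> Arr C" "j \<in> Arr C" "p \<in> Arr C" "q \<in> Arr C"
    "Dom C i = X" "Cod C i = P" "Dom C j = Y" "Cod C j = P"
    "Dom C p = P" "Cod C p = X" "Dom C q = P" "Cod C q = Y"
    "p \<cdot> i = Ident C X" "q \<cdot> j = Ident C Y" "q \<cdot> i = Zero C X Y" "p \<cdot> j = Zero C Y X"
    "(i \<cdot> p) \<boxplus> (j \<cdot> q) = Ident C P"
  using assms by (auto simp: biproduct_def Hom_def)

lemma biproduct_reassoc:
  assumes "biproduct P X Y i j p q" and "f \<in> Arr C"
  shows "Cod C f = X \<Longrightarrow> p \<cdot> (i \<cdot> f) = f" "Cod C f = Y \<Longrightarrow> q \<cdot> (j \<cdot> f) = f"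
    "Cod C f = X \<Longrightarrow> q \<cdot> (i \<cdot> f) = Zero C (Dom C f) Y"
    "Cod C f = Y \<Longrightarrow> p \<cdot> (j \<cdot> f) = Zero C (Dom C f) X"
  using biproductD[OF assms(1)] assms(2)
  by (simp_all add: comp_comp_eq[of p i "Ident C X"] comp_comp_eq[of q j "Ident C Y"]
      comp_comp_eq[of q i "Zero C X Y"] comp_comp_eq[of p j "Zero C Y X"])

lemma biproduct_sym:
  assumes "biproduct P X Y i j p q"
  shows "biproduct P Y X j i q p"
  using biproductD[OF assms] unfolding biproduct_def by (simp add: Hom_def add_comm)

lemma biproduct_split_into:
  assumes b: "biproduct P X Y i j p q" and "t \<in> Arr C" "Cod C t = P"
  shows "t = (i \<cdot> (p \<cdot> t)) \<boxplus> (j \<cdot> (q \<cdot> t))"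
proof -
  have "((i \<cdot> p) \<boxplus> (j \<cdot> q)) \<cdot> t = (i \<cdot> (p \<cdot> t)) \<boxplus> (j \<cdot> (q \<cdot> t))"
    using biproductD(1-15)[OF b] assms(2,3) by (simp add: comp_add_left comp_assoc)
  then show ?thesis using biproductD(20)[OF b] assms by simp
qed

lemma biproduct_eqI_into:
  assumes b: "biproduct P X Y i j p q" and "t \<in> Arr C" "Cod C t = P" "t' \<in> Arr C" "Cod C t' = P"
    and "p \<cdot> t = p \<cdot> t'" "q \<cdot> t = q \<cdot> t'"
  shows "t = t'"
  using biproduct_split_into[OF b assms(2,3)] biproduct_split_into[OF b assms(4,5)] assms(6,7) by metis

text \<open>The map \<open>X \<oplus> Y \<rightarrow> X' \<oplus> Y'\<close> induced by \<open>f\<close> and \<open>g\<close>, from the injections of the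
  target and the projections of the source.\<close>

definition sum_map :: "'b \<Rightarrow> 'b \<Rightarrow> 'b \<Rightarrow> 'b \<Rightarrow> 'b \<Rightarrow> 'b \<Rightarrow> 'b" where
  "sum_map i' j' p q f g = (i' \<cdot> (f \<cdot> p)) \<boxplus> (j' \<cdot> (g \<cdot> q))"

lemma sum_map_simps:
  assumes b: "biproduct P X Y i j p q" and b': "biproduct P' X' Y' i' j' p' q'"
    and f: "f \<in> Arr C" "Dom C f = X" "Cod C f = X'" and g: "g \<in> Arr C" "Dom C g = Y" "Cod C g = Y'"
  shows "sum_map i' j' p q f g \<in> Arr C" "Dom C (sum_map i' j' p q f g) = P"
    "Cod C (sum_map i' j' p q f g) = P'"
    "p' \<cdot> sum_map i' j' p q f g = f \<cdot> p" "q' \<cdot> sum_map i' j' p q f g = g \<cdot> q"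
    "sum_map i' j' p q f g \<cdot> i = i' \<cdot> f" "sum_map i' j' p q f g \<cdot> j = j' \<cdot> g"
  unfolding sum_map_def using f g biproductD(1-19)[OF b] biproductD(1-19)[OF b']
    biproduct_reassoc[OF b] biproduct_reassoc[OF b']
  by (simp_all add: comp_add_left comp_add_right comp_assoc)

lemma sum_map_comp:
  assumes b: "biproduct P X Y i j p q" and b': "biproduct P' X' Y' i' j' p' q'"
    and b'': "biproduct P'' X'' Y'' i'' j'' p'' q''"
    and f: "f \<in> Arr C" "Dom C f = X" "Cod C f = X'" and g: "g \<in> Arr C" "Dom C g = Y" "Cod C g = Y'"
    and f': "f' \<in> Arr C" "Dom C f' = X'" "Cod C f' = X''"
    and g': "g' \<in> Arr C" "Dom C g' = Y'" "Cod C g' = Y''"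
  shows "sum_map i'' j'' p' q' f' g' \<cdot> sum_map i' j' p q f g
    = sum_map i'' j'' p q (f' \<cdot> f) (g' \<cdot> g)"
proof -
  note 1 = sum_map_simps[OF b b' f g] and 2 = sum_map_simps[OF b' b'' f' g']
  have 3: "f' \<cdot> f \<in> Arr C" "Dom C (f' \<cdot> f) = X" "Cod C (f' \<cdot> f) = X''"
    "g' \<cdot> g \<in> Arr C" "Dom C (g' \<cdot> g) = Y" "Cod C (g' \<cdot> g) = Y''"
    using f g f' g' by auto
  note 4 = sum_map_simps[OF b b'' 3]
  note bD = biproductD(1-15)[OF b] biproductD(1-15)[OF b'] biproductD(1-15)[OF b'']
  show ?thesis
  proof (rule biproduct_eqI_into[OF b''])
    show "p'' \<cdot> (sum_map i'' j'' p' q' f' g' \<cdot> sum_map i' j' p q f g)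
        = p'' \<cdot> sum_map i'' j'' p q (f' \<cdot> f) (g' \<cdot> g)"
      using 1 2 4 bD f g f' g' by (simp add: comp_comp_eq[OF 2(4)] comp_assoc)
    show "q'' \<cdot> (sum_map i'' j'' p' q' f' g' \<cdot> sum_map i' j' p q f g)
        = q'' \<cdot> sum_map i'' j'' p q (f' \<cdot> f) (g' \<cdot> g)"
      using 1 2 4 bD f g f' g' by (simp add: comp_comp_eq[OF 2(5)] comp_assoc)
  qed (use 1 2 4 in simp_all)
qed

lemma sum_map_ident:
  assumes b: "biproduct P X Y i j p q"
  shows "sum_map i j p q (Ident C X) (Ident C Y) = Ident C P"
  unfolding sum_map_def using biproductD[OF b] by simp

lemma biproduct_cong:
  assumes b: "biproduct P X Y i j p q" and b': "biproduct P' X' Y' i' j' p' q'"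
    and "isomorphic C X X'" "isomorphic C Y Y'"
  shows "isomorphic C P P'"
proof -
  obtain f f' where f: "f \<in> Arr C" "Dom C f = X" "Cod C f = X'"
    and f': "f' \<in> Arr C" "Dom C f' = X'" "Cod C f' = X"
    and ff': "f' \<cdot> f = Ident C X" "f \<cdot> f' = Ident C X'"
    using assms(3) by (elim isomorphicE)
  obtain g g' where g: "g \<in> Arr C" "Dom C g = Y" "Cod C g = Y'"
    and g': "g' \<in> Arr C" "Dom C g' = Y'" "Cod C g' = Y"
    and gg': "g' \<cdot> g = Ident C Y" "g \<cdot> g' = Ident C Y'"
    using assms(4) by (elim isomorphicE)
  show ?thesis
  proof (rule isomorphicI[of "sum_map i' j' p q f g" "sum_map i j p' q' f' g'"])
    show "sum_map i j p' q' f' g' \<cdot> sum_map i' j' p q f g = Ident C P"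
      using sum_map_comp[OF b b' b f g f' g'] sum_map_ident[OF b] ff' gg' by simp
    show "sum_map i' j' p q f g \<cdot> sum_map i j p' q' f' g' = Ident C P'"
      using sum_map_comp[OF b' b b' f' g' f g] sum_map_ident[OF b'] ff' gg' by simp
  qed (use sum_map_simps[OF b b' f g] sum_map_simps[OF b' b f' g'] in simp_all)
qed

text \<open>
  With \<open>P = X \<oplus> Y\<close> and \<open>R = Y \<oplus> Z\<close>, the arrow \<open>R \<rightarrow> Q\<close> has components \<open>Y \<rightarrow> P \<rightarrow> Q\<close> and
  \<open>Z \<rightarrow> Q\<close>, and dually for \<open>Q \<rightarrow> R\<close>.
\<close>

lemma biproduct_assoc:
  assumes P: "biproduct P X Y i j p q" and Q: "biproduct Q P Z k l r s"
    and R: "biproduct R Y Z i' j' p' q'"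
  shows "\<exists>i j p q. biproduct Q X R i j p q"
proof -
  note D = biproductD(1-19)[OF P] biproductD(1-19)[OF Q] biproductD(1-19)[OF R]
    biproduct_reassoc[OF P] biproduct_reassoc[OF Q] biproduct_reassoc[OF R]
  define I where "I = k \<cdot> i"
  define J where "J = (k \<cdot> (j \<cdot> p')) \<boxplus> (l \<cdot> q')"
  define p'' where "p'' = p \<cdot> r"
  define q'' where "q'' = (i' \<cdot> (q \<cdot> r)) \<boxplus> (j' \<cdot> s)"
  have A: "I \<in> Arr C" "Dom C I = X" "Cod C I = Q" "J \<in> Arr C" "Dom C J = R" "Cod C J = Q"
    "p'' \<in> Arr C" "Dom C p'' = Q" "Cod C p'' = X" "q'' \<in> Arr C" "Dom C q'' = Q" "Cod C q'' = R"
    unfolding I_def J_def p''_def q''_def using D by simp_all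
  have 1: "p'' \<cdot> I = Ident C X" "p'' \<cdot> J = Zero C R X" "q'' \<cdot> I = Zero C X R"
    unfolding I_def J_def p''_def q''_def using D
    by (simp_all add: comp_add_left comp_add_right comp_assoc)
  have 2: "q'' \<cdot> J = Ident C R"
    unfolding J_def q''_def using D biproductD(20)[OF R]
    by (simp add: comp_add_left comp_add_right comp_assoc)
  have 3: "(I \<cdot> p'') \<boxplus> (J \<cdot> q'') = Ident C Q"
  proof (rule biproduct_eqI_into[OF Q])
    show "r \<cdot> ((I \<cdot> p'') \<boxplus> (J \<cdot> q'')) = r \<cdot> Ident C Q"
      using D biproduct_split_into[OF P, of r, symmetric] unfolding I_def J_def p''_def q''_def
      by (simp add: comp_add_left comp_add_right comp_assoc)
    show "s \<cdot> ((I \<cdot> p'') \<boxplus> (J \<cdot> q'')) = s \<cdot> Ident C Q"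
      using D unfolding I_def J_def p''_def q''_def
      by (simp add: comp_add_left comp_add_right comp_assoc)
  qed (use A D in simp_all)
  have "biproduct Q X R I J p'' q''"
    unfolding biproduct_def Hom_def using A 1 2 3 D(1-3) D(20,24) by (simp add: D)
  then show ?thesis by blast
qed

lemma biproduct_zero:
  assumes "X \<in> Obj C" "zero_object C Z"
  shows "biproduct X X Z (Ident C X) (Zero C Z X) (Ident C X) (Zero C X Z)"
  unfolding biproduct_def Hom_def
  using assms zero_objectD[OF assms(2)] zero_objectD(2)[OF assms(2), of "Ident C Z"] by simp

text \<open>
  This says that \<open>Hom(T, X) \<rightarrow> Hom(T, Y) \<rightarrow> Hom(T, Z)\<close> is exact for every object \<open>T\<close>, where
  \<open>X \<rightarrow> Y \<rightarrow> Z\<close> are the arrows \<open>f\<close> and \<open>g\<close>.  Unlike exactness of a triangle, this condition can be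
  checked componentwise on direct sums, and by the five lemma it suffices to recognise exact
  triangles once a comparison with an exact triangle is given.
\<close>

definition hom_exact :: "'b \<Rightarrow> 'b \<Rightarrow> bool" where
  "hom_exact f g \<longleftrightarrow> f \<in> Arr C \<and> g \<in> Arr C \<and> Cod C f = Dom C g \<and>
     g \<cdot> f = Zero C (Dom C f) (Cod C g) \<and>
     (\<forall>t \<in> Arr C. Cod C t = Dom C g \<longrightarrow> g \<cdot> t = Zero C (Dom C t) (Cod C g) \<longrightarrow>
        (\<exists>s \<in> Arr C. Dom C s = Dom C t \<and> Cod C s = Dom C f \<and> f \<cdot> s = t))"

lemma hom_exact_lift:
  assumes "hom_exact f g" "t \<in> Arr C" "Cod C t = Dom C g" "g \<cdot> t = Zero C (Dom C t) (Cod C g)"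
  obtains s where "s \<in> Arr C" "Dom C s = Dom C t" "Cod C s = Dom C f" "f \<cdot> s = t"
  using assms unfolding hom_exact_def by blast

lemma hom_exactD:
  assumes "hom_exact f g"
  shows "f \<in> Arr C" "g \<in> Arr C" "Cod C f = Dom C g" "g \<cdot> f = Zero C (Dom C f) (Cod C g)"
  using assms unfolding hom_exact_def by blast+

text \<open>
  An arrow into a biproduct is determined by its two components, so it is killed if and only if
  both components are, and it lifts if both components lift.
\<close>

lemma hom_exact_sum:
  assumes b: "biproduct P X X' i j p q" and b': "biproduct Q Y Y' k l r s"
    and b'': "biproduct R Z Z' m n u v"
    and fg: "hom_exact f g" and fg': "hom_exact f' g'"
    and o: "Dom C f = X" "Cod C f = Y" "Cod C g = Z" "Dom C f' = X'" "Cod C f' = Y'" "Cod C g' = Z'"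
  shows "hom_exact (sum_map k l p q f f') (sum_map m n r s g g')"
proof -
  note D = biproductD(1-15)[OF b] biproductD(1-15)[OF b'] biproductD(1-15)[OF b'']
  note fgD = hom_exactD[OF fg] and fgD' = hom_exactD[OF fg']
  have o': "Dom C g = Y" "Dom C g' = Y'" using fgD fgD' o by auto
  note F = sum_map_simps[OF b b' fgD(1) o(1,2) fgD'(1) o(4,5)]
  note G = sum_map_simps[OF b' b'' fgD(2) o'(1) o(3) fgD'(2) o'(2) o(6)]
  show ?thesis
    unfolding hom_exact_def
  proof (intro conjI ballI impI)
    show "sum_map m n r s g g' \<cdot> sum_map k l p q f f'
      = Zero C (Dom C (sum_map k l p q f f')) (Cod C (sum_map m n r s g g'))"
      using sum_map_comp[OF b b' b'' fgD(1) o(1,2) fgD'(1) o(4,5) fgD(2) o'(1) o(3) fgD'(2) o'(2) o(6)]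
        F G fgD(4) fgD'(4) o D by (simp add: sum_map_def)
    fix t assume t: "t \<in> Arr C" "Cod C t = Dom C (sum_map m n r s g g')"
      and gt: "sum_map m n r s g g' \<cdot> t = Zero C (Dom C t) (Cod C (sum_map m n r s g g'))"
    have tQ: "Cod C t = Q" using t G by simp
    have gt': "sum_map m n r s g g' \<cdot> t = Zero C (Dom C t) R" using gt G by simp
    have "g \<cdot> (r \<cdot> t) = u \<cdot> (sum_map m n r s g g' \<cdot> t)"
      using G D o' o fgD fgD' t by (simp add: comp_comp_eq[OF G(4)] comp_assoc)
    then have "g \<cdot> (r \<cdot> t) = Zero C (Dom C (r \<cdot> t)) (Cod C g)"
      unfolding gt' using D t tQ o by simp
    then obtain a where a: "a \<in> Arr C" "Dom C a = Dom C t" "Cod C a = X" "f \<cdot> a = r \<cdot> t"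
      using hom_exact_lift[OF fg, of "r \<cdot> t"] D t tQ o o' by auto
    have "g' \<cdot> (s \<cdot> t) = v \<cdot> (sum_map m n r s g g' \<cdot> t)"
      using G D o' o fgD fgD' t by (simp add: comp_comp_eq[OF G(5)] comp_assoc)
    then have "g' \<cdot> (s \<cdot> t) = Zero C (Dom C (s \<cdot> t)) (Cod C g')"
      unfolding gt' using D t tQ o by simp
    then obtain a' where a': "a' \<in> Arr C" "Dom C a' = Dom C t" "Cod C a' = X'" "f' \<cdot> a' = s \<cdot> t"
      using hom_exact_lift[OF fg', of "s \<cdot> t"] D t tQ o o' by auto
    let ?s = "(i \<cdot> a) \<boxplus> (j \<cdot> a')"
    have s: "?s \<in> Arr C" "Dom C ?s = Dom C t" "Cod C ?s = P" using a a' D by simp_all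
    have "sum_map k l p q f f' \<cdot> ?s = (k \<cdot> (r \<cdot> t)) \<boxplus> (l \<cdot> (s \<cdot> t))"
      using F D a a' o fgD fgD'
      by (simp add: comp_add_right comp_comp_eq[OF F(6)] comp_comp_eq[OF F(7)] comp_assoc)
    then have "sum_map k l p q f f' \<cdot> ?s = t"
      using biproduct_split_into[OF b' t(1) tQ] by simp
    then show "\<exists>s\<in>Arr C. Dom C s = Dom C t \<and> Cod C s = Dom C (sum_map k l p q f f') \<and>
        sum_map k l p q f f' \<cdot> s = t"
      using s F by auto
  qed (use F G in simp_all)
qed

end

section \<open>Exact triangles and their direct sums\<close>

context additive_category_with_shift
begin

lemma shift_obj [simp]: "X \<in> Obj C \<Longrightarrow> Shift C X \<in> Obj C"
  by (rule Shift_closed)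

lemma shift_simps [simp]:
  assumes "f \<in> Arr C"
  shows "Shift_arr C f \<in> Arr C" "Dom C (Shift_arr C f) = Shift C (Dom C f)"
    "Cod C (Shift_arr C f) = Shift C (Cod C f)"
  using Shift_arr_closed[of f "Dom C f" "Cod C f"] assms by (auto simp: Hom_def)

lemma shift_comp:
  "\<lbrakk>f \<in> Arr C; g \<in> Arr C; Cod C f = Dom C g\<rbrakk>
   \<Longrightarrow> Shift_arr C (g \<cdot> f) = Shift_arr C g \<cdot> Shift_arr C f"
  by (rule Shift_Comp[of f "Dom C f" "Dom C g" g "Cod C g"]) (auto simp: Hom_def)

lemma shift_add:
  "\<lbrakk>f \<in> Arr C; g \<in> Arr C; Dom C f = Dom C g; Cod C f = Cod C g\<rbrakk>
   \<Longrightarrow> Shift_arr C (f \<boxplus> g) = Shift_arr C f \<boxplus> Shift_arr C g"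
  by (rule Shift_Add[of f "Dom C f" "Cod C f"]) (auto simp: Hom_def)

lemma shift_zero [simp]:
  assumes "X \<in> Obj C" "Y \<in> Obj C"
  shows "Shift_arr C (Zero C X Y) = Zero C (Shift C X) (Shift C Y)"
proof -
  have "Shift_arr C (Zero C X Y) \<boxplus> Shift_arr C (Zero C X Y) = Shift_arr C (Zero C X Y)"
    using shift_add[of "Zero C X Y" "Zero C X Y", symmetric] assms by simp
  then show ?thesis
    using add_cancel[of "Shift_arr C (Zero C X Y)" "Shift_arr C (Zero C X Y)"] assms by simp
qed

lemma shift_faithful:
  assumes "Shift_arr C f = Shift_arr C g" "f \<in> Arr C" "g \<in> Arr C" "Dom C f = Dom C g" "Cod C f = Cod C g"
  shows "f = g"
proof -
  have "bij_betw (Shift_arr C) (Hom C (Dom C g) (Cod C g))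
      (Hom C (Shift C (Dom C g)) (Shift C (Cod C g)))"
    using assms by (intro Shift_fully_faithful) auto
  then show ?thesis
    using assms by (auto simp: bij_betw_def Hom_def dest: inj_onD)
qed

lemma shift_full:
  assumes "t \<in> Arr C" "Dom C t = Shift C X" "Cod C t = Shift C Y" "X \<in> Obj C" "Y \<in> Obj C"
  obtains s where "s \<in> Arr C" "Dom C s = X" "Cod C s = Y" "Shift_arr C s = t"
proof -
  have "t \<in> Shift_arr C ` Hom C X Y"
    using Shift_fully_faithful[OF assms(4,5)] assms by (auto simp: bij_betw_def Hom_def)
  then show thesis using that by (auto simp: Hom_def)
qed

lemma shift_zero_object:
  assumes "zero_object C Z"
  shows "zero_object C (Shift C Z)"
proof (rule zero_objectI)
  have Z: "Z \<in> Obj C" by (rule zero_objectD(1)[OF assms])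
  then show "Shift C Z \<in> Obj C" by simp
  have "Ident C Z = Zero C Z Z" using zero_objectD(2)[OF assms, of "Ident C Z"] Z by simp
  then show "Ident C (Shift C Z) = Zero C (Shift C Z) (Shift C Z)"
    using Shift_Ident[OF Z] Z by simp
qed

lemma shift_biproduct:
  assumes "biproduct P X Y i j p q"
  shows "biproduct (Shift C P) (Shift C X) (Shift C Y)
    (Shift_arr C i) (Shift_arr C j) (Shift_arr C p) (Shift_arr C q)"
proof -
  note D = biproductD[OF assms]
  have "Shift_arr C ((i \<cdot> p) \<boxplus> (j \<cdot> q)) = Ident C (Shift C P)"
    unfolding D(20) using D(1) by (rule Shift_Ident)
  then have "(Shift_arr C i \<cdot> Shift_arr C p) \<boxplus> (Shift_arr C j \<cdot> Shift_arr C q) = Ident C (Shift C P)"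
    using D(1-15) by (simp add: shift_add shift_comp)
  then show ?thesis
    unfolding biproduct_def Hom_def using D(1-19) by (simp add: Shift_Ident flip: shift_comp)
qed

lemma shift_sum_map:
  assumes b: "biproduct P X Y i j p q" and b': "biproduct P' X' Y' i' j' p' q'"
    and f: "f \<in> Arr C" "Dom C f = X" "Cod C f = X'" and g: "g \<in> Arr C" "Dom C g = Y" "Cod C g = Y'"
  shows "Shift_arr C (sum_map i' j' p q f g) =
    sum_map (Shift_arr C i') (Shift_arr C j') (Shift_arr C p) (Shift_arr C q)
      (Shift_arr C f) (Shift_arr C g)"
  unfolding sum_map_def using f g biproductD(1-15)[OF b] biproductD(1-15)[OF b']
  by (simp add: shift_add shift_comp)

end

context triangulated_category
begin

lemma exactD:
  assumes "(f, g, h) \<in> Exact C"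
  shows "f \<in> Arr C" "g \<in> Arr C" "h \<in> Arr C" "Dom C g = Cod C f" "Dom C h = Cod C g"
    "Cod C h = Shift C (Dom C f)"
  using Exact_triangle[OF assms] unfolding triangle_def by auto

lemma exact_rotate: "(f, g, h) \<in> Exact C \<Longrightarrow> (g, h, Neg C (Shift_arr C f)) \<in> Exact C"
  using TR2 Exact_triangle by blast

text \<open>
  The rotation of this triangle is \<open>X = X \<rightarrow> 0\<close>, with \<open>0[1]\<close> in the role of the zero object.
\<close>

lemma exact_zero_left:
  assumes X: "X \<in> Obj C" and Z: "zero_object C Z"
  shows "(Zero C Z X, Ident C X, Zero C X (Shift C Z)) \<in> Exact C"
proof -
  note Z' = shift_zero_object[OF Z]
  have t: "triangle C (Zero C Z X) (Ident C X) (Zero C X (Shift C Z))"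
    unfolding triangle_def using X zero_objectD(1)[OF Z] by simp
  have "(Ident C X, Zero C X (Shift C Z), Neg C (Shift_arr C (Zero C Z X))) \<in> Exact C"
    using TR1_Ident[OF X Z'] X zero_objectD(1)[OF Z] by simp
  then show ?thesis using TR2[OF t] by simp
qed

text \<open>The functors \<open>Hom(T, _)\<close> are exact on an exact triangle: comparing it with
  \<open>X = X \<rightarrow> 0\<close> shows that consecutive arrows compose to zero, and comparing \<open>T \<rightarrow> 0 \<rightarrow> T[1]\<close>
  with the rotation of the given triangle lifts arrows along \<open>f[1]\<close>, hence, the shift being
  fully faithful, along \<open>f\<close>.\<close>

lemma exact_imp_hom_exact:
  assumes e: "(f, g, h) \<in> Exact C"
  shows "hom_exact f g"
proof -
  note D = exactD[OF e]
  obtain Z where Z: "zero_object C Z" using ex_zero_object by blast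
  note ZD = zero_objectD[OF Z]
  have 1: "(Ident C (Dom C f), Zero C (Dom C f) Z, Zero C Z (Shift C (Dom C f))) \<in> Exact C"
    using TR1_Ident[OF _ Z] D by simp
  have "\<exists>c \<in> Hom C (Dom C (Zero C Z (Shift C (Dom C f)))) (Dom C h).
      c \<cdot> Zero C (Dom C f) Z = g \<cdot> f \<and>
      Shift_arr C (Ident C (Dom C f)) \<cdot> Zero C Z (Shift C (Dom C f)) = h \<cdot> c"
    by (rule TR3[OF 1 e]) (use D ZD(1) in \<open>simp_all add: Hom_def\<close>)
  then have gf: "g \<cdot> f = Zero C (Dom C f) (Cod C g)"
    using D ZD(1) by (auto simp: Hom_def)
  have lift: "\<exists>s \<in> Arr C. Dom C s = Dom C t \<and> Cod C s = Dom C f \<and> f \<cdot> s = t"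
    if t: "t \<in> Arr C" "Cod C t = Dom C g" and gt: "g \<cdot> t = Zero C (Dom C t) (Cod C g)" for t
  proof -
    let ?T = "Dom C t"
    have T: "?T \<in> Obj C" using t by simp
    have 2: "(Zero C ?T Z, Zero C Z (Shift C ?T), Neg C (Shift_arr C (Ident C ?T))) \<in> Exact C"
      by (rule exact_rotate[OF TR1_Ident[OF T Z]])
    have "\<exists>c \<in> Hom C (Dom C (Neg C (Shift_arr C (Ident C ?T)))) (Dom C (Neg C (Shift_arr C f))).
        c \<cdot> Zero C Z (Shift C ?T) = h \<cdot> Zero C Z (Cod C g) \<and>
        Shift_arr C t \<cdot> Neg C (Shift_arr C (Ident C ?T)) = Neg C (Shift_arr C f) \<cdot> c"
      by (rule TR3[OF 2 exact_rotate[OF e]]) (use D ZD(1) T t gt in \<open>simp_all add: Hom_def\<close>)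
    then obtain c where c: "c \<in> Arr C" "Dom C c = Shift C ?T" "Cod C c = Shift C (Dom C f)"
      and ec: "Shift_arr C t \<cdot> Neg C (Shift_arr C (Ident C ?T)) = Neg C (Shift_arr C f) \<cdot> c"
      using D T by (auto simp: Hom_def)
    obtain s where s: "s \<in> Arr C" "Dom C s = ?T" "Cod C s = Dom C f" "Shift_arr C s = c"
      using shift_full[OF c] T D by auto
    have "Neg C (Shift_arr C t) = Neg C (Shift_arr C (f \<cdot> s))"
      using ec s c T D t by (simp add: Shift_Ident shift_comp)
    then have "Neg C (Neg C (Shift_arr C t)) = Neg C (Neg C (Shift_arr C (f \<cdot> s)))"
      by simp
    then have "Shift_arr C t = Shift_arr C (f \<cdot> s)"
      using s t D by simp
    then have "t = f \<cdot> s"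
      by (rule shift_faithful) (use s t D in simp_all)
    then show ?thesis using s by blast
  qed
  show ?thesis
    unfolding hom_exact_def using D gf lift by auto
qed

text \<open>
  Removes the sign that rotation puts on the shifted arrow.
\<close>

lemma hom_exact_neg_right:
  assumes "hom_exact f (Neg C g)" "g \<in> Arr C"
  shows "hom_exact f g"
proof -
  have *: "Neg C k = Zero C (Dom C k) (Cod C k) \<longleftrightarrow> k = Zero C (Dom C k) (Cod C k)"
    if "k \<in> Arr C" for k
    using that neg_neg[OF that] neg_zero[of "Dom C k" "Cod C k"] by (metis dom_cod_closed)
  have D: "f \<in> Arr C" "Cod C f = Dom C g"
    using assms unfolding hom_exact_def by auto
  have gf: "g \<cdot> f = Zero C (Dom C f) (Cod C g)"
    using *[of "g \<cdot> f"] assms D unfolding hom_exact_def by auto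
  have "\<exists>s\<in>Arr C. Dom C s = Dom C t \<and> Cod C s = Dom C f \<and> f \<cdot> s = t"
    if "t \<in> Arr C" "Cod C t = Dom C g" "g \<cdot> t = Zero C (Dom C t) (Cod C g)" for t
    using hom_exact_lift[OF assms(1), of t] *[of "g \<cdot> t"] that assms(2) by auto
  then show ?thesis
    unfolding hom_exact_def using D assms(2) gf by blast
qed

lemma exact_hom_exact_all:
  assumes e: "(f, g, h) \<in> Exact C"
  shows "hom_exact f g" "hom_exact g h" "hom_exact h (Shift_arr C f)"
proof -
  note e1 = exact_rotate[OF e]
  show "hom_exact f g" by (rule exact_imp_hom_exact[OF e])
  show "hom_exact g h" by (rule exact_imp_hom_exact[OF e1])
  have "hom_exact h (Neg C (Shift_arr C f))"
    by (rule exact_imp_hom_exact[OF exact_rotate[OF e1]])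
  then show "hom_exact h (Shift_arr C f)"
    by (rule hom_exact_neg_right) (use exactD[OF e] in simp)
qed

text \<open>
  A form of the five lemma: a triangle \<open>(f, g, h)\<close> that is only known to be \<open>Hom\<close>-exact, and that
  maps to an exact triangle on the same first arrow, is isomorphic to it.  A diagram chase in
  \<open>Hom(T, _)\<close> shows that \<open>\<phi>\<close> is a monomorphism, and a second one, with \<open>T\<close> the target of \<open>\<phi>\<close>
  and started at the identity of \<open>T\<close>, gives a right inverse of \<open>\<phi>\<close>.
\<close>

lemma hom_exact_imp_exact:
  assumes t: "triangle C f g h"
    and fg: "hom_exact f g" and gh: "hom_exact g h" and hf: "hom_exact h (Shift_arr C f)"
    and e: "(f, G, H) \<in> Exact C"
    and \<phi>: "\<phi> \<in> Arr C" "Dom C \<phi> = Cod C g" "Cod C \<phi> = Cod C G" "\<phi> \<cdot> g = G" "H \<cdot> \<phi> = h"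
  shows "(f, g, h) \<in> Exact C"
proof -
  note D = exactD[OF e]
  have d: "f \<in> Arr C" "g \<in> Arr C" "h \<in> Arr C" "Dom C g = Cod C f" "Dom C h = Cod C g"
    "Cod C h = Shift C (Dom C f)"
    using t unfolding triangle_def by auto
  note ex = exact_hom_exact_all[OF e]
  have mono: "t = Zero C (Dom C t) (Cod C g)"
    if t: "t \<in> Arr C" "Cod C t = Cod C g" "\<phi> \<cdot> t = Zero C (Dom C t) (Cod C G)" for t
  proof -
    have "h \<cdot> t = H \<cdot> (\<phi> \<cdot> t)"
      using comp_comp_eq[OF \<phi>(5), of t] t \<phi> D d by simp
    then have "h \<cdot> t = Zero C (Dom C t) (Cod C h)"
      using t D d \<phi> by simp
    then obtain s where s: "s \<in> Arr C" "Dom C s = Dom C t" "Cod C s = Dom C g" "g \<cdot> s = t"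
      using hom_exact_lift[OF gh t(1)] t d by auto
    have "G \<cdot> s = \<phi> \<cdot> (g \<cdot> s)"
      using comp_comp_eq[OF \<phi>(4), of s] s \<phi> d by simp
    then have "G \<cdot> s = Zero C (Dom C s) (Cod C G)"
      using s t by simp
    then obtain r where r: "r \<in> Arr C" "Dom C r = Dom C s" "Cod C r = Dom C f" "f \<cdot> r = s"
      using hom_exact_lift[OF ex(1) s(1)] s d D by auto
    have "g \<cdot> (f \<cdot> r) = Zero C (Dom C r) (Cod C g)"
      using comp_comp_eq[OF hom_exactD(4)[OF fg], of r] r d by simp
    then show ?thesis using r s by simp
  qed
  let ?W = "Cod C G"
  let ?Z = "Cod C g"
  have W: "?W \<in> Obj C" "?Z \<in> Obj C" using D d by auto
  have "Shift_arr C f \<cdot> H = Zero C (Dom C H) (Shift C (Cod C f))"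
    using hom_exactD(4)[OF ex(3)] D by simp
  then obtain a where a: "a \<in> Arr C" "Dom C a = ?W" "Cod C a = ?Z" "h \<cdot> a = H"
    using hom_exact_lift[OF hf, of H] D d by auto
  \<comment> \<open>\<open>a\<close> is a right inverse of \<open>\<phi>\<close> up to the error \<open>?w\<close>, which \<open>H\<close> kills and which therefore comes from \<open>G\<close>\<close>
  let ?w = "Ident C ?W \<boxplus> Neg C (\<phi> \<cdot> a)"
  have w: "?w \<in> Arr C" "Dom C ?w = ?W" "Cod C ?w = ?W"
    using a \<phi> W by simp_all
  have "H \<cdot> (\<phi> \<cdot> a) = H"
    using comp_comp_eq[OF \<phi>(5), of a] a \<phi> D d by simp
  then have "H \<cdot> ?w = Zero C (Dom C ?w) (Cod C H)"
    using a \<phi> W D by (simp add: comp_add_right)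
  then obtain s where s: "s \<in> Arr C" "Dom C s = ?W" "Cod C s = Dom C G" "G \<cdot> s = ?w"
    using hom_exact_lift[OF ex(2) w(1)] w D by auto
  define \<psi> where "\<psi> = a \<boxplus> (g \<cdot> s)"
  have \<psi>: "\<psi> \<in> Arr C" "Dom C \<psi> = ?W" "Cod C \<psi> = ?Z"
    unfolding \<psi>_def using a s d D by simp_all
  have "\<phi> \<cdot> \<psi> = (\<phi> \<cdot> a) \<boxplus> ?w"
    unfolding \<psi>_def s(4)[symmetric] using a s d D \<phi>
    by (simp add: comp_add_right comp_comp_eq[OF \<phi>(4)])
  also have "\<dots> = ?w \<boxplus> (\<phi> \<cdot> a)"
    using w a \<phi> by (intro add_comm) simp_all
  also have "\<dots> = Ident C ?W \<boxplus> (Neg C (\<phi> \<cdot> a) \<boxplus> (\<phi> \<cdot> a))"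
    using w a \<phi> W by (intro add_assoc) simp_all
  also have "Neg C (\<phi> \<cdot> a) \<boxplus> (\<phi> \<cdot> a) = (\<phi> \<cdot> a) \<boxplus> Neg C (\<phi> \<cdot> a)"
    using a \<phi> by (intro add_comm) simp_all
  also have "Ident C ?W \<boxplus> \<dots> = Ident C ?W"
    using a \<phi> W by simp
  finally have \<phi>\<psi>: "\<phi> \<cdot> \<psi> = Ident C ?W" .
  \<comment> \<open>a monomorphism with a right inverse is an isomorphism\<close>
  have "(\<psi> \<cdot> \<phi>) \<boxplus> Neg C (Ident C ?Z) = Zero C ?Z ?Z"
  proof -
    have "\<phi> \<cdot> (\<psi> \<cdot> \<phi>) = \<phi>"
      using comp_comp_eq[OF \<phi>\<psi>, of \<phi>] \<phi> \<psi> by simp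
    then have "\<phi> \<cdot> ((\<psi> \<cdot> \<phi>) \<boxplus> Neg C (Ident C ?Z)) = Zero C ?Z ?W"
      using \<phi> \<psi> W by (simp add: comp_add_right)
    then show ?thesis
      using mono[of "(\<psi> \<cdot> \<phi>) \<boxplus> Neg C (Ident C ?Z)"] \<phi> \<psi> W by simp
  qed
  then have \<psi>\<phi>: "\<psi> \<cdot> \<phi> = Ident C ?Z"
    using neg_unique(2)[of "\<psi> \<cdot> \<phi>" "Neg C (Ident C ?Z)"] \<phi> \<psi> W by simp
  show ?thesis
  proof (rule TR1_iso[OF e t, of "Ident C (Dom C f)" "Ident C (Dom C g)" \<psi>])
    show "is_iso C (Dom C f) (Dom C f) (Ident C (Dom C f))"
      unfolding is_iso_def Hom_def using d by auto
    show "is_iso C (Dom C G) (Dom C g) (Ident C (Dom C g))"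
      unfolding is_iso_def Hom_def using d D by (auto intro!: bexI[of _ "Ident C (Dom C g)"])
    show "is_iso C (Dom C H) (Dom C h) \<psi>"
      unfolding is_iso_def Hom_def using \<phi>\<psi> \<psi>\<phi> \<phi> \<psi> d D by (auto intro!: bexI[of _ \<phi>])
    show "\<psi> \<cdot> G = g \<cdot> Ident C (Dom C g)"
      using comp_comp_eq[OF \<psi>\<phi>, of g] \<phi> \<psi> d by simp
    show "Shift_arr C (Ident C (Dom C f)) \<cdot> H = h \<cdot> \<psi>"
      using comp_comp_eq[OF \<phi>(5), of \<psi>] \<phi>\<psi> \<phi> \<psi> d D by (simp add: Shift_Ident)
  qed (use d in simp)
qed

text \<open>
  The axioms provide an exact triangle on the arrow \<open>f \<oplus> f'\<close>, but not that its third object is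
  the direct sum of the two cones.  The axiom (TR3), applied to the two injections, maps both given
  triangles to that triangle; the two maps of cones together form the comparison \<open>\<phi>\<close> required by
  the five lemma.
\<close>

lemma exact_sum:
  assumes e: "(f, g, h) \<in> Exact C" and e': "(f', g', h') \<in> Exact C"
    and P: "biproduct P (Dom C f) (Dom C f') i j p q"
    and Q: "biproduct Q (Cod C f) (Cod C f') k l r s"
    and R: "biproduct R (Cod C g) (Cod C g') m n u v"
  shows "(sum_map k l p q f f', sum_map m n r s g g',
    sum_map (Shift_arr C i) (Shift_arr C j) u v h h') \<in> Exact C"
proof -
  note D = exactD[OF e] exactD[OF e']
  note b = biproductD(1-19)[OF P] biproductD(1-19)[OF Q] biproductD(1-19)[OF R]
  note ex = exact_hom_exact_all[OF e] and ex' = exact_hom_exact_all[OF e']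
  let ?F = "sum_map k l p q f f'" and ?G = "sum_map m n r s g g'"
    and ?H = "sum_map (Shift_arr C i) (Shift_arr C j) u v h h'"
  note P' = shift_biproduct[OF P] and Q' = shift_biproduct[OF Q]
  have F: "?F \<in> Arr C" "Dom C ?F = P" "Cod C ?F = Q" "?F \<cdot> i = k \<cdot> f" "?F \<cdot> j = l \<cdot> f'"
    using sum_map_simps[OF P Q, of f f'] D by simp_all
  have G: "?G \<in> Arr C" "Dom C ?G = Q" "Cod C ?G = R" "u \<cdot> ?G = g \<cdot> r" "v \<cdot> ?G = g' \<cdot> s"
    using sum_map_simps[OF Q R, of g g'] D by simp_all
  have H: "?H \<in> Arr C" "Dom C ?H = R" "Cod C ?H = Shift C P"
    using sum_map_simps[OF R P', of h h'] D by simp_all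
  have FG: "hom_exact ?F ?G"
    by (rule hom_exact_sum[OF P Q R ex(1) ex'(1)]) simp_all
  have GH: "hom_exact ?G ?H"
    by (rule hom_exact_sum[OF Q R P' ex(2) ex'(2)]) (use D in simp_all)
  have HF: "hom_exact ?H (Shift_arr C ?F)"
    unfolding shift_sum_map[OF P Q D(1) refl refl D(7) refl refl]
    by (rule hom_exact_sum[OF R P' Q' ex(3) ex'(3)]) (use D in simp_all)
  have T: "triangle C ?F ?G ?H"
    unfolding triangle_def using F G H by simp
  obtain G0 H0 where e0: "(?F, G0, H0) \<in> Exact C" using TR1_cone[OF F(1)] by blast
  note D0 = exactD[OF e0]
  have "\<exists>c \<in> Hom C (Dom C h) (Dom C H0). c \<cdot> g = G0 \<cdot> k \<and> Shift_arr C i \<cdot> h = H0 \<cdot> c"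
    by (rule TR3[OF e e0]) (use F D0 D b in \<open>simp_all add: Hom_def\<close>)
  then obtain c where c: "c \<in> Arr C" "Dom C c = Cod C g" "Cod C c = Cod C G0" "c \<cdot> g = G0 \<cdot> k"
    "H0 \<cdot> c = Shift_arr C i \<cdot> h"
    using D D0 by (auto simp: Hom_def)
  have "\<exists>c \<in> Hom C (Dom C h') (Dom C H0). c \<cdot> g' = G0 \<cdot> l \<and> Shift_arr C j \<cdot> h' = H0 \<cdot> c"
    by (rule TR3[OF e' e0]) (use F D0 D b in \<open>simp_all add: Hom_def\<close>)
  then obtain c' where c': "c' \<in> Arr C" "Dom C c' = Cod C g'" "Cod C c' = Cod C G0"
    "c' \<cdot> g' = G0 \<cdot> l" "H0 \<cdot> c' = Shift_arr C j \<cdot> h'"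
    using D D0 by (auto simp: Hom_def)
  define \<phi> where "\<phi> = (c \<cdot> u) \<boxplus> (c' \<cdot> v)"
  have \<phi>: "\<phi> \<in> Arr C" "Dom C \<phi> = R" "Cod C \<phi> = Cod C G0"
    unfolding \<phi>_def using c c' b by simp_all
  have "\<phi> \<cdot> ?G = (c \<cdot> (g \<cdot> r)) \<boxplus> (c' \<cdot> (g' \<cdot> s))"
    unfolding \<phi>_def using c(1-3) c'(1-3) b G by (simp add: comp_add_left comp_assoc)
  also have "\<dots> = (G0 \<cdot> (k \<cdot> r)) \<boxplus> (G0 \<cdot> (l \<cdot> s))"
    using c(1-3) c'(1-3) b D D0 F by (simp add: comp_comp_eq[OF c(4)] comp_comp_eq[OF c'(4)] comp_assoc)
  also have "\<dots> = G0 \<cdot> ((k \<cdot> r) \<boxplus> (l \<cdot> s))"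
    using b D0 F by (simp add: comp_add_right)
  also have "\<dots> = G0"
    using biproductD(20)[OF Q] D0 F by simp
  finally have 1: "\<phi> \<cdot> ?G = G0" .
  have 2: "H0 \<cdot> \<phi> = ?H"
    unfolding \<phi>_def sum_map_def using c(1-3) c'(1-3) b D D0
    by (simp add: comp_add_right comp_comp_eq[OF c(5)] comp_comp_eq[OF c'(5)] comp_assoc)
  show ?thesis
    by (rule hom_exact_imp_exact[OF T FG GH HF e0 \<phi>(1)]) (use \<phi> G 1 2 in simp_all)
qed

end

section \<open>Objects up to isomorphism\<close>

context category
begin

abbreviation iso_obj  (infix "\<simeq>" 50) where
  "X \<simeq> Y \<equiv> isomorphic C X Y"

end

context additive_category
begin

definition dsum  (infixl "\<oplus>\<^sub>o" 65) where
  "X \<oplus>\<^sub>o Y = (SOME P. \<exists>i j p q. biproduct P X Y i j p q)"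

lemma dsum_biproduct:
  assumes "X \<in> Obj C" "Y \<in> Obj C"
  obtains i j p q where "biproduct (X \<oplus>\<^sub>o Y) X Y i j p q"
proof -
  have "\<exists>P. \<exists>i j p q. biproduct P X Y i j p q"
    unfolding biproduct_def using ex_biproduct[OF assms] assms by blast
  from someI_ex[OF this] show thesis
    unfolding dsum_def[symmetric] using that by blast
qed

lemma dsum_obj [simp]: "\<lbrakk>X \<in> Obj C; Y \<in> Obj C\<rbrakk> \<Longrightarrow> X \<oplus>\<^sub>o Y \<in> Obj C"
  by (erule (1) dsum_biproduct) (rule biproductD(1))

lemma biproduct_iso_dsum:
  assumes "biproduct P X Y i j p q"
  shows "P \<simeq> X \<oplus>\<^sub>o Y"
proof -
  have o: "X \<in> Obj C" "Y \<in> Obj C" using biproductD[OF assms] by auto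
  then obtain i' j' p' q' where "biproduct (X \<oplus>\<^sub>o Y) X Y i' j' p' q'"
    by (rule dsum_biproduct)
  from biproduct_cong[OF assms this] show ?thesis
    using o by (simp add: isomorphic_refl)
qed

lemma dsum_cong:
  assumes "X \<simeq> X'" "Y \<simeq> Y'"
  shows "X \<oplus>\<^sub>o Y \<simeq> X' \<oplus>\<^sub>o Y'"
proof -
  have o: "X \<in> Obj C" "Y \<in> Obj C" "X' \<in> Obj C" "Y' \<in> Obj C"
    using isomorphic_obj assms by auto
  obtain i j p q where b: "biproduct (X \<oplus>\<^sub>o Y) X Y i j p q"
    using o(1,2) by (rule dsum_biproduct)
  obtain i' j' p' q' where b': "biproduct (X' \<oplus>\<^sub>o Y') X' Y' i' j' p' q'"
    using o(3,4) by (rule dsum_biproduct)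
  show ?thesis by (rule biproduct_cong[OF b b' assms])
qed

lemma dsum_comm:
  assumes "X \<in> Obj C" "Y \<in> Obj C"
  shows "X \<oplus>\<^sub>o Y \<simeq> Y \<oplus>\<^sub>o X"
  using dsum_biproduct[OF assms] biproduct_iso_dsum biproduct_sym by metis

lemma dsum_assoc:
  assumes "X \<in> Obj C" "Y \<in> Obj C" "Z \<in> Obj C"
  shows "(X \<oplus>\<^sub>o Y) \<oplus>\<^sub>o Z \<simeq> X \<oplus>\<^sub>o (Y \<oplus>\<^sub>o Z)"
proof -
  obtain i j p q where 1: "biproduct (X \<oplus>\<^sub>o Y) X Y i j p q"
    using assms(1,2) by (rule dsum_biproduct)
  obtain i j p q where 2: "biproduct (X \<oplus>\<^sub>o Y \<oplus>\<^sub>o Z) (X \<oplus>\<^sub>o Y) Z i j p q"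
    using dsum_obj[OF assms(1,2)] assms(3) by (rule dsum_biproduct)
  obtain i j p q where 3: "biproduct (Y \<oplus>\<^sub>o Z) Y Z i j p q"
    using assms(2,3) by (rule dsum_biproduct)
  show ?thesis using biproduct_assoc[OF 1 2 3] biproduct_iso_dsum by blast
qed

lemma dsum_zero:
  assumes "X \<in> Obj C" "zero_object C Z"
  shows "X \<oplus>\<^sub>o Z \<simeq> X"
  using biproduct_iso_dsum[OF biproduct_zero[OF assms]] by (rule isomorphic_sym)

lemma dsum_interchange:
  assumes "X \<in> Obj C" "X' \<in> Obj C" "Y \<in> Obj C" "Y' \<in> Obj C"
  shows "(X \<oplus>\<^sub>o X') \<oplus>\<^sub>o (Y \<oplus>\<^sub>o Y') \<simeq> (X \<oplus>\<^sub>o Y) \<oplus>\<^sub>o (X' \<oplus>\<^sub>o Y')"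
proof -
  have "(X \<oplus>\<^sub>o X') \<oplus>\<^sub>o (Y \<oplus>\<^sub>o Y') \<simeq> X \<oplus>\<^sub>o (X' \<oplus>\<^sub>o (Y \<oplus>\<^sub>o Y'))"
    using assms by (simp add: dsum_assoc)
  also have "\<dots> \<simeq> X \<oplus>\<^sub>o (X' \<oplus>\<^sub>o Y \<oplus>\<^sub>o Y')"
    using assms by (intro dsum_cong isomorphic_refl isomorphic_sym[OF dsum_assoc])
  also have "\<dots> \<simeq> X \<oplus>\<^sub>o (Y \<oplus>\<^sub>o X' \<oplus>\<^sub>o Y')"
    using assms by (intro dsum_cong isomorphic_refl dsum_comm)
  also have "\<dots> \<simeq> X \<oplus>\<^sub>o (Y \<oplus>\<^sub>o (X' \<oplus>\<^sub>o Y'))"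
    using assms by (intro dsum_cong isomorphic_refl dsum_assoc)
  also have "\<dots> \<simeq> (X \<oplus>\<^sub>o Y) \<oplus>\<^sub>o (X' \<oplus>\<^sub>o Y')"
    using assms by (intro isomorphic_sym[OF dsum_assoc]) simp_all
  finally show ?thesis .
qed

end

lemma (in additive_category_with_shift) shift_dsum:
  assumes "X \<in> Obj C" "Y \<in> Obj C"
  shows "Shift C (X \<oplus>\<^sub>o Y) \<simeq> Shift C X \<oplus>\<^sub>o Shift C Y"
  using dsum_biproduct[OF assms] shift_biproduct biproduct_iso_dsum by metis

context triangulated_category
begin

text \<open>
  An exact triangle on the objects \<open>X\<close>, \<open>Y\<close>, \<open>Z\<close> with its arrows forgotten.  Triangulated
  subcategories and the Grothendieck group only depend on this relation, so that from here on the
  arguments are about objects up to isomorphism.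
\<close>

definition tri where
  "tri X Y Z \<longleftrightarrow> (\<exists>f g h. (f, g, h) \<in> Exact C \<and> Dom C f = X \<and> Cod C f = Y \<and> Cod C g = Z)"

lemma triI: "(f, g, h) \<in> Exact C \<Longrightarrow> tri (Dom C f) (Cod C f) (Cod C g)"
  unfolding tri_def by blast

lemma tri_obj:
  assumes "tri X Y Z"
  shows "X \<in> Obj C" "Y \<in> Obj C" "Z \<in> Obj C"
  using assms exactD unfolding tri_def by auto

lemma tri_rotate:
  assumes "tri X Y Z"
  shows "tri Y Z (Shift C X)"
proof -
  obtain f g h where e: "(f, g, h) \<in> Exact C" "Dom C f = X" "Cod C f = Y" "Cod C g = Z"
    using assms unfolding tri_def by blast
  show ?thesis using triI[OF exact_rotate[OF e(1)]] exactD[OF e(1)] e by simp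
qed

lemma tri_sum:
  assumes "tri X Y Z" "tri X' Y' Z'"
  shows "tri (X \<oplus>\<^sub>o X') (Y \<oplus>\<^sub>o Y') (Z \<oplus>\<^sub>o Z')"
proof -
  obtain f g h where e: "(f, g, h) \<in> Exact C" and o: "Dom C f = X" "Cod C f = Y" "Cod C g = Z"
    using assms(1) unfolding tri_def by blast
  obtain f' g' h' where e': "(f', g', h') \<in> Exact C"
    and o': "Dom C f' = X'" "Cod C f' = Y'" "Cod C g' = Z'"
    using assms(2) unfolding tri_def by blast
  note D = exactD[OF e] exactD[OF e']
  obtain i j p q where P: "biproduct (X \<oplus>\<^sub>o X') X X' i j p q"
    using tri_obj(1)[OF assms(1)] tri_obj(1)[OF assms(2)] by (rule dsum_biproduct)
  obtain k l r s where Q: "biproduct (Y \<oplus>\<^sub>o Y') Y Y' k l r s"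
    using tri_obj(2)[OF assms(1)] tri_obj(2)[OF assms(2)] by (rule dsum_biproduct)
  obtain m n u v where R: "biproduct (Z \<oplus>\<^sub>o Z') Z Z' m n u v"
    using tri_obj(3)[OF assms(1)] tri_obj(3)[OF assms(2)] by (rule dsum_biproduct)
  from triI[OF exact_sum[OF e e', unfolded o o', OF P Q R]] show ?thesis
    using sum_map_simps[OF P Q, of f f'] sum_map_simps[OF Q R, of g g'] D o o' by simp
qed

lemma tri_iso:
  assumes "tri X Y Z" "X \<simeq> X'" "Y \<simeq> Y'" "Z \<simeq> Z'"
  shows "tri X' Y' Z'"
proof -
  obtain f g h where e: "(f, g, h) \<in> Exact C" and o: "Dom C f = X" "Cod C f = Y" "Cod C g = Z"
    using assms(1) unfolding tri_def by blast
  note D = exactD[OF e]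
  obtain a a' where a: "is_iso C X X' a" "a \<in> Arr C" "Dom C a = X" "Cod C a = X'"
    "a' \<in> Arr C" "Dom C a' = X'" "Cod C a' = X" "a' \<cdot> a = Ident C X"
    using assms(2) unfolding isomorphic_def is_iso_def Hom_def by auto
  obtain b b' where b: "is_iso C Y Y' b" "b \<in> Arr C" "Dom C b = Y" "Cod C b = Y'"
    "b' \<in> Arr C" "Dom C b' = Y'" "Cod C b' = Y" "b' \<cdot> b = Ident C Y"
    using assms(3) unfolding isomorphic_def is_iso_def Hom_def by auto
  obtain c c' where c: "is_iso C Z Z' c" "c \<in> Arr C" "Dom C c = Z" "Cod C c = Z'"
    "c' \<in> Arr C" "Dom C c' = Z'" "Cod C c' = Z" "c' \<cdot> c = Ident C Z"
    using assms(4) unfolding isomorphic_def is_iso_def Hom_def by auto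
  have sa: "Shift_arr C a' \<cdot> Shift_arr C a = Ident C (Shift C X)"
    using a tri_obj[OF assms(1)] by (simp add: Shift_Ident flip: shift_comp)
  let ?f = "b \<cdot> (f \<cdot> a')" and ?g = "c \<cdot> (g \<cdot> b')" and ?h = "Shift_arr C a \<cdot> (h \<cdot> c')"
  have "(?f, ?g, ?h) \<in> Exact C"
  proof (rule TR1_iso[OF e, of _ _ _ a b c])
    show "triangle C ?f ?g ?h" unfolding triangle_def using a b c D o by simp
    show "b \<cdot> f = ?f \<cdot> a" "c \<cdot> g = ?g \<cdot> b" "Shift_arr C a \<cdot> h = ?h \<cdot> c"
      using a b c D o by (simp_all add: comp_assoc)
  qed (use a b c D o in simp_all)
  from triI[OF this] show ?thesis using a b c D o by simp
qed

lemma tri_ident: "\<lbrakk>X \<in> Obj C; zero_object C Z\<rbrakk> \<Longrightarrow> tri X X Z"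
  using triI[OF TR1_Ident] zero_objectD(1) by simp

lemma tri_zero_left: "\<lbrakk>X \<in> Obj C; zero_object C Z\<rbrakk> \<Longrightarrow> tri Z X X"
  using triI[OF exact_zero_left] zero_objectD(1) by simp

lemma tri_shift: "\<lbrakk>X \<in> Obj C; zero_object C Z\<rbrakk> \<Longrightarrow> tri X Z (Shift C X)"
  by (rule tri_rotate[OF tri_ident])

text \<open>
  The direct sum of the triangles \<open>X = X \<rightarrow> 0\<close> and \<open>0 \<rightarrow> Y = Y\<close>.
\<close>

lemma tri_dsum:
  assumes "X \<in> Obj C" "Y \<in> Obj C"
  shows "tri X (X \<oplus>\<^sub>o Y) Y"
proof -
  obtain Z where Z: "zero_object C Z" using ex_zero_object by blast
  have "tri (X \<oplus>\<^sub>o Z) (X \<oplus>\<^sub>o Y) (Z \<oplus>\<^sub>o Y)"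
    using assms Z by (intro tri_sum tri_ident tri_zero_left)
  moreover have "Z \<oplus>\<^sub>o Y \<simeq> Y"
    using dsum_comm[of Z Y] dsum_zero[OF assms(2) Z] zero_objectD(1)[OF Z] assms
    by (auto intro: isomorphic_trans)
  ultimately show ?thesis
    by (rule tri_iso[OF _ dsum_zero[OF assms(1) Z] isomorphic_refl[OF dsum_obj[OF assms]]])
qed

section \<open>Triangulated subcategories and their summands\<close>

lemma triangulated_subcategoryI:
  assumes "S \<subseteq> Obj C" "S \<noteq> {}" "\<And>X Y. \<lbrakk>X \<in> S; X \<simeq> Y\<rbrakk> \<Longrightarrow> Y \<in> S"
    "\<And>X. X \<in> S \<Longrightarrow> Shift C X \<in> S" "\<And>X. \<lbrakk>X \<in> Obj C; Shift C X \<in> S\<rbrakk> \<Longrightarrow> X \<in> S"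
    "\<And>X Y Z. \<lbrakk>tri X Y Z; X \<in> S; Y \<in> S\<rbrakk> \<Longrightarrow> Z \<in> S"
  shows "triangulated_subcategory C S"
  unfolding triangulated_subcategory_def using assms triI by blast

lemma triangulated_subcategory_closed:
  assumes "triangulated_subcategory C S"
  shows "S \<subseteq> Obj C" "S \<noteq> {}" "\<And>X Y. \<lbrakk>X \<in> S; X \<simeq> Y\<rbrakk> \<Longrightarrow> Y \<in> S"
    "\<And>X. X \<in> S \<Longrightarrow> Shift C X \<in> S" "\<And>X. \<lbrakk>X \<in> Obj C; Shift C X \<in> S\<rbrakk> \<Longrightarrow> X \<in> S"
    "\<And>X Y Z. \<lbrakk>tri X Y Z; X \<in> S; Y \<in> S\<rbrakk> \<Longrightarrow> Z \<in> S"
  using assms isomorphic_obj unfolding triangulated_subcategory_def tri_def by blast+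

text \<open>
  A triangulated subcategory contains the third object of a triangle along with the first two.
  Rotation makes this two-out-of-three, since membership can be tested after a shift.
\<close>

lemma triangulated_subcategory_left:
  assumes S: "triangulated_subcategory C S" and t: "tri X Y Z" and "Y \<in> S" "Z \<in> S"
  shows "X \<in> S"
  using triangulated_subcategory_closed(5)[OF S tri_obj(1)[OF t]]
    triangulated_subcategory_closed(6)[OF S tri_rotate[OF t]] assms(3,4) by blast

lemma triangulated_subcategory_middle:
  assumes S: "triangulated_subcategory C S" and t: "tri X Y Z" and "X \<in> S" "Z \<in> S"
  shows "Y \<in> S"
  using triangulated_subcategory_left[OF S tri_rotate[OF t]]
    triangulated_subcategory_closed(4)[OF S] assms(3,4) by blast

lemma triangulated_subcategory_zero:
  assumes S: "triangulated_subcategory C S" and Z: "zero_object C Z"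
  shows "Z \<in> S"
proof -
  obtain X where X: "X \<in> S" "X \<in> Obj C" using triangulated_subcategory_closed(1,2)[OF S] by blast
  show ?thesis using triangulated_subcategory_closed(6)[OF S tri_ident[OF X(2) Z]] X by blast
qed

lemma triangulated_subcategory_dsum:
  assumes S: "triangulated_subcategory C S" and "X \<in> S" "Y \<in> S"
  shows "X \<oplus>\<^sub>o Y \<in> S"
  using triangulated_subcategory_middle[OF S tri_dsum] triangulated_subcategory_closed(1)[OF S]
    assms(2,3) by blast

lemma triangulated_subcategory_cancel:
  assumes S: "triangulated_subcategory C S" and "X \<oplus>\<^sub>o Y \<in> S" "Y \<in> S" "X \<in> Obj C"
  shows "X \<in> S"
  using triangulated_subcategory_left[OF S tri_dsum] triangulated_subcategory_closed(1)[OF S]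
    assms(2-4) by blast

lemma triangulated_subcategory_Obj: "triangulated_subcategory C (Obj C)"
  using ex_zero_object zero_objectD(1) tri_obj isomorphic_obj
  by (intro triangulated_subcategoryI) auto

lemma triangulated_closure:
  assumes "G \<subseteq> Obj C" "G \<noteq> {}"
  shows "triangulated_subcategory C (triangulated_closure C G)"
    "G \<subseteq> triangulated_closure C G"
    "\<And>S. \<lbrakk>triangulated_subcategory C S; G \<subseteq> S\<rbrakk> \<Longrightarrow> triangulated_closure C G \<subseteq> S"
proof -
  let ?T = "triangulated_closure C G"
  show "G \<subseteq> ?T" unfolding triangulated_closure_def by blast
  show least: "?T \<subseteq> S" if "triangulated_subcategory C S" "G \<subseteq> S" for S
    using that unfolding triangulated_closure_def by blast
  have TI: "X \<in> ?T" if "\<And>S. \<lbrakk>triangulated_subcategory C S; ?T \<subseteq> S\<rbrakk> \<Longrightarrow> X \<in> S" for X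
    unfolding triangulated_closure_def using that least by blast
  show "triangulated_subcategory C ?T"
  proof (rule triangulated_subcategoryI)
    show "?T \<subseteq> Obj C" using least[OF triangulated_subcategory_Obj assms(1)] .
    show "?T \<noteq> {}" using \<open>G \<subseteq> ?T\<close> assms(2) by blast
    show "Y \<in> ?T" if "X \<in> ?T" "X \<simeq> Y" for X Y
      by (rule TI) (use that triangulated_subcategory_closed(3) in blast)
    show "Shift C X \<in> ?T" if "X \<in> ?T" for X
      by (rule TI) (use that triangulated_subcategory_closed(4) in blast)
    show "X \<in> ?T" if "X \<in> Obj C" "Shift C X \<in> ?T" for X
      by (rule TI) (use that triangulated_subcategory_closed(5) in blast)
    show "Z \<in> ?T" if "tri X Y Z" "X \<in> ?T" "Y \<in> ?T" for X Y Z
      by (rule TI) (use that triangulated_subcategory_closed(6) in blast)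
  qed
qed

text \<open>
  The direct summands of objects of \<open>S\<close>; \<open>S\<close> is dense if these are all objects.
\<close>

definition summands where
  "summands S = {X \<in> Obj C. \<exists>X' \<in> Obj C. X \<oplus>\<^sub>o X' \<in> S}"

text \<open>
  If \<open>X'\<close> and \<open>Y'\<close> are complements of \<open>X\<close> and \<open>Y\<close> in \<open>S\<close>, then adding the triangles
  \<open>X' \<rightarrow> 0 \<rightarrow> X'[1]\<close> and \<open>0 \<rightarrow> Y' = Y'\<close> to \<open>X \<rightarrow> Y \<rightarrow> Z\<close> gives a triangle whose first two objects
  are in \<open>S\<close>; so \<open>X'[1] \<oplus> Y'\<close> is a complement of \<open>Z\<close>.
\<close>

lemma summands_triangulated:
  assumes S: "triangulated_subcategory C S"
  shows "triangulated_subcategory C (summands S)"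
proof (rule triangulated_subcategoryI)
  note cl = triangulated_subcategory_closed[OF S]
  obtain N where N: "zero_object C N" using ex_zero_object by blast
  note No = zero_objectD(1)[OF N]
  show "summands S \<subseteq> Obj C" unfolding summands_def by blast
  have "N \<oplus>\<^sub>o N \<in> S"
    using triangulated_subcategory_dsum[OF S] triangulated_subcategory_zero[OF S N] by blast
  then show "summands S \<noteq> {}" unfolding summands_def using No by blast
  show "Y \<in> summands S" if hyp: "X \<in> summands S" "X \<simeq> Y" for X Y
  proof -
    obtain X' where X': "X' \<in> Obj C" "X \<oplus>\<^sub>o X' \<in> S" using hyp unfolding summands_def by blast
    have "Y \<oplus>\<^sub>o X' \<in> S"
      by (rule cl(3)[OF X'(2)]) (use hyp X' in \<open>auto intro: dsum_cong isomorphic_refl\<close>)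
    then show ?thesis unfolding summands_def using X' isomorphic_obj[OF hyp(2)] by blast
  qed
  show "Shift C X \<in> summands S" if hyp: "X \<in> summands S" for X
  proof -
    obtain X' where X': "X \<in> Obj C" "X' \<in> Obj C" "X \<oplus>\<^sub>o X' \<in> S"
      using hyp unfolding summands_def by blast
    have "Shift C X \<oplus>\<^sub>o Shift C X' \<in> S"
      by (rule cl(3)[OF cl(4)[OF X'(3)] shift_dsum[OF X'(1,2)]])
    then show ?thesis unfolding summands_def using X' by auto
  qed
  show "X \<in> summands S" if hyp: "X \<in> Obj C" "Shift C X \<in> summands S" for X
  proof -
    obtain V where V: "V \<in> Obj C" "Shift C X \<oplus>\<^sub>o V \<in> S" using hyp unfolding summands_def by blast
    obtain X' where X': "X' \<in> Obj C" "Shift C X' \<simeq> V" using Shift_ess_surj[OF V(1)] by blast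
    have "Shift C X \<oplus>\<^sub>o V \<simeq> Shift C X \<oplus>\<^sub>o Shift C X'"
      using hyp X' by (intro dsum_cong isomorphic_refl isomorphic_sym[OF X'(2)]) simp
    also have "\<dots> \<simeq> Shift C (X \<oplus>\<^sub>o X')"
      using hyp X' by (intro isomorphic_sym[OF shift_dsum])
    finally have "Shift C (X \<oplus>\<^sub>o X') \<in> S" using cl(3)[OF V(2)] by blast
    then have "X \<oplus>\<^sub>o X' \<in> S" using cl(5) hyp X' by auto
    then show ?thesis unfolding summands_def using hyp X' by blast
  qed
  show "Z \<in> summands S" if t: "tri X Y Z" and XY: "X \<in> summands S" "Y \<in> summands S" for X Y Z
  proof -
    obtain X' where X': "X' \<in> Obj C" "X \<oplus>\<^sub>o X' \<in> S" using XY unfolding summands_def by blast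
    obtain Y' where Y': "Y' \<in> Obj C" "Y \<oplus>\<^sub>o Y' \<in> S" using XY unfolding summands_def by blast
    note o = tri_obj[OF t]
    have "tri (X \<oplus>\<^sub>o (X' \<oplus>\<^sub>o N)) (Y \<oplus>\<^sub>o (N \<oplus>\<^sub>o Y')) (Z \<oplus>\<^sub>o (Shift C X' \<oplus>\<^sub>o Y'))"
      using X' Y' by (intro tri_sum t tri_shift[OF _ N] tri_zero_left[OF _ N])
    moreover have "X \<oplus>\<^sub>o (X' \<oplus>\<^sub>o N) \<simeq> X \<oplus>\<^sub>o X'"
      using o X' by (intro dsum_cong dsum_zero[OF _ N] isomorphic_refl)
    then have "X \<oplus>\<^sub>o (X' \<oplus>\<^sub>o N) \<in> S" using cl(3)[OF X'(2)] isomorphic_sym by blast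
    moreover have "N \<oplus>\<^sub>o Y' \<simeq> Y'"
      using dsum_comm[OF No Y'(1)] dsum_zero[OF Y'(1) N] by (rule isomorphic_trans)
    then have "Y \<oplus>\<^sub>o (N \<oplus>\<^sub>o Y') \<simeq> Y \<oplus>\<^sub>o Y'"
      using o by (intro dsum_cong isomorphic_refl)
    then have "Y \<oplus>\<^sub>o (N \<oplus>\<^sub>o Y') \<in> S" using cl(3)[OF Y'(2)] isomorphic_sym by blast
    ultimately have "Z \<oplus>\<^sub>o (Shift C X' \<oplus>\<^sub>o Y') \<in> S" using cl(6) by blast
    then show ?thesis unfolding summands_def using o X' Y' by auto
  qed
qed

end

section \<open>The Grothendieck group\<close>

context triangulated_category
begin

lemma K0_relations_eq:
  "K0_relations C = {frag_of (iso_class C Y) - (frag_of (iso_class C X) + frag_of (iso_class C Z)) |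
     X Y Z. tri X Y Z}"
  unfolding K0_relations_def tri_def by blast

lemma K0_relations_carrier: "K0_relations C \<subseteq> carrier (K0_free C)"
proof
  fix r assume "r \<in> K0_relations C"
  then obtain X Y Z where t: "tri X Y Z"
    and r: "r = frag_of (iso_class C Y) - (frag_of (iso_class C X) + frag_of (iso_class C Z))"
    unfolding K0_relations_eq by blast
  have "Poly_Mapping.keys r \<subseteq> {iso_class C X, iso_class C Y, iso_class C Z}"
    unfolding r using keys_diff[of "frag_of (iso_class C Y)"]
      keys_add[of "frag_of (iso_class C X)" "frag_of (iso_class C Z)"]
    by (fastforce simp: keys_frag_of)
  then show "r \<in> carrier (K0_free C)" using tri_obj[OF t] by (auto simp: K0_free_def)
qed

lemma K0_free_comm_group: "comm_group (K0_free C)"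
  unfolding K0_free_def by (rule abelian_free_Abelian_group)

lemma K0_normal: "generate (K0_free C) (K0_relations C) \<lhd> K0_free C"
proof -
  interpret F: comm_group "K0_free C" by (rule K0_free_comm_group)
  show ?thesis
    using F.generate_is_subgroup[OF K0_relations_carrier] by (rule F.normal_iff_subgroup[THEN iffD2])
qed

lemma K0_comm_group: "comm_group (K0 C)"
proof -
  interpret F: comm_group "K0_free C" by (rule K0_free_comm_group)
  show ?thesis
    unfolding K0_def using F.generate_is_subgroup[OF K0_relations_carrier] by (rule F.abelian_FactGroup)
qed

definition K0_coset where
  "K0_coset x = generate (K0_free C) (K0_relations C) #>\<^bsub>K0_free C\<^esub> x"

definition K0_class where
  "K0_class X = K0_coset (frag_of (iso_class C X))"

lemma K0_carrier: "carrier (K0 C) = K0_coset ` carrier (K0_free C)"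
  unfolding K0_def K0_coset_def by (rule carrier_FactGroup)

lemma K0_coset_hom: "K0_coset \<in> hom (K0_free C) (K0 C)"
  unfolding K0_def K0_coset_def[abs_def] by (rule normal.r_coset_hom_Mod[OF K0_normal])

lemma K0_frag_closed: "X \<in> Obj C \<Longrightarrow> frag_of (iso_class C X) \<in> carrier (K0_free C)"
  unfolding K0_free_def by simp

lemma K0_class_closed: "X \<in> Obj C \<Longrightarrow> K0_class X \<in> carrier (K0 C)"
  unfolding K0_class_def K0_carrier using K0_frag_closed by blast

lemma K0_class_iso: "X \<simeq> Y \<Longrightarrow> K0_class X = K0_class Y"
  unfolding K0_class_def by (simp add: iso_class_eq)

lemma K0_class_tri:
  assumes t: "tri X Y Z"
  shows "K0_class Y = K0_class X \<otimes>\<^bsub>K0 C\<^esub> K0_class Z"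
proof -
  interpret F: comm_group "K0_free C" by (rule K0_free_comm_group)
  interpret K: comm_group "K0 C" by (rule K0_comm_group)
  interpret h: group_hom "K0_free C" "K0 C" K0_coset
    using K0_coset_hom by unfold_locales
  let ?x = "frag_of (iso_class C X)" and ?y = "frag_of (iso_class C Y)"
    and ?z = "frag_of (iso_class C Z)"
  let ?N = "generate (K0_free C) (K0_relations C)"
  have r: "?y - (?x + ?z) \<in> K0_relations C"
    unfolding K0_relations_eq using t by blast
  then have rN: "?y - (?x + ?z) \<in> ?N" by (rule generate.incl)
  have rF: "?y - (?x + ?z) \<in> carrier (K0_free C)" using r K0_relations_carrier by blast
  have c: "?x \<in> carrier (K0_free C)" "?z \<in> carrier (K0_free C)"
    using tri_obj[OF t] K0_frag_closed by auto
  have add: "a \<otimes>\<^bsub>K0_free C\<^esub> b = a + b" for a b by (simp add: K0_free_def)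
  have 1: "K0_coset (?y - (?x + ?z)) = \<one>\<^bsub>K0 C\<^esub>"
    unfolding K0_coset_def K0_def
    using F.coset_join2[OF rF F.generate_is_subgroup[OF K0_relations_carrier] rN] by simp
  have "?y = (?y - (?x + ?z)) \<otimes>\<^bsub>K0_free C\<^esub> (?x \<otimes>\<^bsub>K0_free C\<^esub> ?z)"
    by (simp add: add)
  then have "K0_coset ?y = K0_coset ((?y - (?x + ?z)) \<otimes>\<^bsub>K0_free C\<^esub> (?x \<otimes>\<^bsub>K0_free C\<^esub> ?z))"
    by simp
  also have "\<dots> = K0_coset ?x \<otimes>\<^bsub>K0 C\<^esub> K0_coset ?z"
    using rF c 1 by simp
  finally show ?thesis unfolding K0_class_def .
qed

lemma K0_class_zero:
  assumes "zero_object C N"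
  shows "K0_class N = \<one>\<^bsub>K0 C\<^esub>"
proof -
  interpret K: comm_group "K0 C" by (rule K0_comm_group)
  have N: "N \<in> Obj C" by (rule zero_objectD(1)[OF assms])
  then show ?thesis
    using K0_class_tri[OF tri_ident[OF N assms]] K.l_cancel_one[OF K0_class_closed K0_class_closed] by metis
qed

lemma K0_class_dsum:
  "\<lbrakk>X \<in> Obj C; Y \<in> Obj C\<rbrakk> \<Longrightarrow> K0_class (X \<oplus>\<^sub>o Y) = K0_class X \<otimes>\<^bsub>K0 C\<^esub> K0_class Y"
  by (rule K0_class_tri[OF tri_dsum])

lemma K0_class_shift:
  assumes X: "X \<in> Obj C"
  shows "K0_class (Shift C X) = inv\<^bsub>K0 C\<^esub> K0_class X"
proof -
  interpret K: comm_group "K0 C" by (rule K0_comm_group)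
  obtain N where N: "zero_object C N" using ex_zero_object by blast
  have "K0_class X \<otimes>\<^bsub>K0 C\<^esub> K0_class (Shift C X) = \<one>\<^bsub>K0 C\<^esub>"
    using K0_class_tri[OF tri_shift[OF X N]] K0_class_zero[OF N] by simp
  then show ?thesis
    using X by (intro K.inv_equality[symmetric]) (simp_all add: K0_class_closed K.m_comm)
qed

text \<open>
  Every element of the Grothendieck group is the class of an object, because sums are realised by
  direct sums and negatives by shifts.  This is what allows generators of the group to be lifted
  to objects.
\<close>

lemma K0_carrier_eq: "carrier (K0 C) = K0_class ` Obj C"
proof
  interpret F: comm_group "K0_free C" by (rule K0_free_comm_group)
  interpret K: comm_group "K0 C" by (rule K0_comm_group)
  interpret h: group_hom "K0_free C" "K0 C" K0_coset
    using K0_coset_hom by unfold_locales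
  show "K0_class ` Obj C \<subseteq> carrier (K0 C)" using K0_class_closed by blast
  obtain N where N: "zero_object C N" using ex_zero_object by blast
  have "K0_coset x \<in> K0_class ` Obj C" if "x \<in> carrier (K0_free C)" for x
  proof -
    have "Poly_Mapping.keys x \<subseteq> iso_class C ` Obj C"
      using that by (simp add: K0_free_def)
    then show ?thesis
    proof (induction rule: free_Abelian_group_induct[consumes 1, case_names zero diff one])
      case zero
      have "K0_coset 0 = K0_class N"
        using h.hom_one K0_class_zero[OF N] by (simp add: K0_free_def)
      then show ?case using zero_objectD(1)[OF N] by blast
    next
      case (diff x y)
      then obtain X Y where XY: "X \<in> Obj C" "K0_coset x = K0_class X" "Y \<in> Obj C" "K0_coset y = K0_class Y"
        by blast
      have c: "x \<in> carrier (K0_free C)" "y \<in> carrier (K0_free C)"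
        using diff by (simp_all add: K0_free_def)
      have "x - y = x \<otimes>\<^bsub>K0_free C\<^esub> inv\<^bsub>K0_free C\<^esub> y"
        using diff by (simp add: K0_free_def)
      then have "K0_coset (x - y) = K0_class X \<otimes>\<^bsub>K0 C\<^esub> inv\<^bsub>K0 C\<^esub> K0_class Y"
        using c XY by simp
      also have "\<dots> = K0_class (X \<oplus>\<^sub>o Shift C Y)"
        using XY by (simp add: K0_class_dsum K0_class_shift)
      finally show ?case using XY by auto
    next
      case (one a)
      then show ?case unfolding K0_class_def by blast
    qed
  qed
  then show "carrier (K0 C) \<subseteq> K0_class ` Obj C" unfolding K0_carrier by blast
qed

text \<open>
  Additivity on triangles makes \<open>\<phi>\<close> invariant under isomorphism, so that it extends to the free
  group on isomorphism classes: along with \<open>X = X \<rightarrow> 0\<close> there is a triangle \<open>X \<rightarrow> Y \<rightarrow> 0\<close> for every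
  \<open>Y\<close> isomorphic to \<open>X\<close>.
\<close>

lemma K0_universal:
  assumes H: "comm_group H" and \<phi>: "\<And>X. X \<in> Obj C \<Longrightarrow> \<phi> X \<in> carrier H"
    and add: "\<And>X Y Z. tri X Y Z \<Longrightarrow> \<phi> Y = \<phi> X \<otimes>\<^bsub>H\<^esub> \<phi> Z"
  obtains \<Phi> where "\<Phi> \<in> hom (K0 C) H" "\<And>X. X \<in> Obj C \<Longrightarrow> \<Phi> (K0_class X) = \<phi> X"
proof -
  interpret H: comm_group H by (rule H)
  interpret F: comm_group "K0_free C" by (rule K0_free_comm_group)
  obtain N where N: "zero_object C N" using ex_zero_object by blast
  have iso: "\<phi> X = \<phi> Y" if "X \<simeq> Y" for X Y
  proof -
    have o: "X \<in> Obj C" "Y \<in> Obj C" using isomorphic_obj[OF that] by auto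
    note t = tri_ident[OF o(1) N]
    have "tri X Y N"
      by (rule tri_iso[OF t isomorphic_refl[OF o(1)] that isomorphic_refl[OF zero_objectD(1)[OF N]]])
    then show ?thesis using add[OF t] add by simp
  qed
  define \<phi>' where "\<phi>' U = \<phi> (SOME X. X \<in> Obj C \<and> U = iso_class C X)" for U
  have \<phi>': "\<phi>' (iso_class C X) = \<phi> X" if X: "X \<in> Obj C" for X
  proof -
    have "(SOME Y. Y \<in> Obj C \<and> iso_class C X = iso_class C Y) \<in> Obj C \<and>
        iso_class C X = iso_class C (SOME Y. Y \<in> Obj C \<and> iso_class C X = iso_class C Y)"
      by (rule someI[of _ X]) (use X in simp)
    then show ?thesis
      unfolding \<phi>'_def using iso iso_class_eqD by metis
  qed
  have "\<phi>' ` (iso_class C ` Obj C) \<subseteq> carrier H" using \<phi>' \<phi> by auto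
  then obtain h where h: "h \<in> hom (K0_free C) H" "\<And>U. U \<in> iso_class C ` Obj C \<Longrightarrow> h (frag_of U) = \<phi>' U"
    using H.free_Abelian_group_universal[of \<phi>' "iso_class C ` Obj C"] unfolding K0_free_def by blast
  interpret h: group_hom "K0_free C" H h using h(1) by unfold_locales
  have hX: "h (frag_of (iso_class C X)) = \<phi> X" if "X \<in> Obj C" for X
    using h(2) \<phi>' that by simp
  have "K0_relations C \<subseteq> kernel (K0_free C) H h"
  proof
    fix r assume r: "r \<in> K0_relations C"
    then obtain X Y Z where t: "tri X Y Z"
      and r_eq: "r = frag_of (iso_class C Y) - (frag_of (iso_class C X) + frag_of (iso_class C Z))"
      unfolding K0_relations_eq by blast
    note o = tri_obj[OF t]
    have rF: "r \<in> carrier (K0_free C)" using r K0_relations_carrier by blast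
    have "frag_of (iso_class C Y) =
        r \<otimes>\<^bsub>K0_free C\<^esub> (frag_of (iso_class C X) \<otimes>\<^bsub>K0_free C\<^esub> frag_of (iso_class C Z))"
      unfolding r_eq by (simp add: K0_free_def)
    then have "h (frag_of (iso_class C Y)) =
        h (r \<otimes>\<^bsub>K0_free C\<^esub> (frag_of (iso_class C X) \<otimes>\<^bsub>K0_free C\<^esub> frag_of (iso_class C Z)))"
      by simp
    then have "\<phi> Y = h r \<otimes>\<^bsub>H\<^esub> \<phi> Y"
      using rF o K0_frag_closed hX add[OF t] by simp
    then have "h r = \<one>\<^bsub>H\<^esub>" using H.r_cancel_one' rF o \<phi> by simp
    then show "r \<in> kernel (K0_free C) H h" using rF by (simp add: kernel_def)
  qed
  then have "generate (K0_free C) (K0_relations C) \<subseteq> kernel (K0_free C) H h"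
    by (rule F.generate_subgroup_incl[OF _ h.subgroup_kernel])
  then obtain \<Phi> where "\<Phi> \<in> hom (K0 C) H" "\<And>x. x \<in> carrier (K0_free C) \<Longrightarrow> \<Phi> (K0_coset x) = h x"
    unfolding K0_def K0_coset_def using h.FactGroup_universal_kernel[OF K0_normal] by metis
  then show thesis using that[of \<Phi>] hX K0_frag_closed unfolding K0_class_def by simp
qed

text \<open>
  The objects whose class lies in a given subgroup of the Grothendieck group form a triangulated
  subcategory.
\<close>

lemma generators_generate_K0:
  assumes G: "generates C G"
  shows "generate (K0 C) (K0_class ` G) = carrier (K0 C)"
proof -
  interpret K: comm_group "K0 C" by (rule K0_comm_group)
  have Go: "G \<subseteq> Obj C" "G \<noteq> {}" "triangulated_closure C G = Obj C"
    using G unfolding generates_def by auto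
  let ?H = "generate (K0 C) (K0_class ` G)"
  have sub: "K0_class ` G \<subseteq> carrier (K0 C)" using Go K0_class_closed by blast
  interpret H: subgroup ?H "K0 C" by (rule K.generate_is_subgroup[OF sub])
  let ?S = "{X \<in> Obj C. K0_class X \<in> ?H}"
  have "triangulated_subcategory C ?S"
  proof (rule triangulated_subcategoryI)
    show "?S \<noteq> {}" using Go generate.incl[of _ "K0_class ` G"] by blast
    show "Y \<in> ?S" if "X \<in> ?S" "X \<simeq> Y" for X Y
      using that K0_class_iso isomorphic_obj by auto
    show "Shift C X \<in> ?S" if "X \<in> ?S" for X
      using that by (simp add: K0_class_shift)
    show "X \<in> ?S" if "X \<in> Obj C" "Shift C X \<in> ?S" for X
    proof -
      have "inv\<^bsub>K0 C\<^esub> K0_class X \<in> ?H" using that by (simp add: K0_class_shift)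
      then have "inv\<^bsub>K0 C\<^esub> (inv\<^bsub>K0 C\<^esub> K0_class X) \<in> ?H" by (rule H.m_inv_closed)
      then show ?thesis using that K0_class_closed by simp
    qed
    show "Z \<in> ?S" if "tri X Y Z" "X \<in> ?S" "Y \<in> ?S" for X Y Z
    proof -
      note o = tri_obj[OF that(1)]
      have "K0_class Z = inv\<^bsub>K0 C\<^esub> K0_class X \<otimes>\<^bsub>K0 C\<^esub> K0_class Y"
        unfolding K0_class_tri[OF that(1)] using o K0_class_closed
        by (simp add: K.m_assoc[symmetric])
      then show ?thesis using that o by simp
    qed
  qed blast
  moreover have "G \<subseteq> ?S" using Go by (auto intro: generate.incl)
  ultimately have "Obj C \<subseteq> ?S" using triangulated_closure(3)[OF Go(1,2)] Go(3) by blast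
  then have "carrier (K0 C) \<subseteq> ?H" unfolding K0_carrier_eq by blast
  then show ?thesis using H.subset by blast
qed

section \<open>Dense triangulated subcategories\<close>

text \<open>
  For dense \<open>S\<close>, the isomorphism classes of objects form a group under direct sum once the objects
  of \<open>S\<close> are identified with zero.  With the relation phrased through a common complement \<open>W\<close>,
  negatives and compatibility with triangles can be read off from membership in \<open>S\<close> alone.
\<close>

definition stable_eq where
  "stable_eq S X Y \<longleftrightarrow> X \<in> Obj C \<and> Y \<in> Obj C \<and> (\<exists>W \<in> Obj C. X \<oplus>\<^sub>o W \<in> S \<and> Y \<oplus>\<^sub>o W \<in> S)"

definition stable_class where
  "stable_class S X = {Y. stable_eq S X Y}"

text \<open>
  The product is defined through all pairs of representatives, which avoids choosing any; the unit
  is \<open>S\<close>, since this is the class of each of its members.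
\<close>

definition stable_group where
  "stable_group S = \<lparr>carrier = stable_class S ` Obj C,
     monoid.mult = (\<lambda>U V. {W. \<exists>X \<in> U. \<exists>Y \<in> V. stable_eq S (X \<oplus>\<^sub>o Y) W}), one = S\<rparr>"

context
  fixes S
  assumes S: "triangulated_subcategory C S" and dense: "summands S = Obj C"
begin

lemma dense_complement:
  assumes "X \<in> Obj C"
  obtains X' where "X' \<in> Obj C" "X \<oplus>\<^sub>o X' \<in> S"
  using assms dense unfolding summands_def by blast

lemma stable_eq_refl: "X \<in> Obj C \<Longrightarrow> stable_eq S X X"
  using dense_complement unfolding stable_eq_def by blast

lemma stable_eq_sym: "stable_eq S X Y \<Longrightarrow> stable_eq S Y X"
  unfolding stable_eq_def by blast

lemma stable_eq_trans:
  assumes "stable_eq S X Y" "stable_eq S Y Z"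
  shows "stable_eq S X Z"
proof -
  note cl = triangulated_subcategory_closed[OF S]
  obtain W where W: "W \<in> Obj C" "X \<oplus>\<^sub>o W \<in> S" "Y \<oplus>\<^sub>o W \<in> S"
    and o: "X \<in> Obj C" "Y \<in> Obj C" "Z \<in> Obj C"
    using assms unfolding stable_eq_def by blast
  obtain V where V: "V \<in> Obj C" "Y \<oplus>\<^sub>o V \<in> S" "Z \<oplus>\<^sub>o V \<in> S"
    using assms unfolding stable_eq_def by blast
  \<comment> \<open>up to reordering, \<open>X \<oplus> ?U\<close> is \<open>(X \<oplus> W) \<oplus> (Y \<oplus> V)\<close>, and \<open>Z \<oplus> ?U\<close> is \<open>(Z \<oplus> V) \<oplus> (Y \<oplus> W)\<close>\<close>
  let ?U = "W \<oplus>\<^sub>o (V \<oplus>\<^sub>o Y)"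
  have VY: "V \<oplus>\<^sub>o Y \<in> S" "W \<oplus>\<^sub>o Y \<in> S"
    using cl(3)[OF V(2) dsum_comm] cl(3)[OF W(3) dsum_comm] o V W by auto
  have "(X \<oplus>\<^sub>o W) \<oplus>\<^sub>o (V \<oplus>\<^sub>o Y) \<in> S"
    using triangulated_subcategory_dsum[OF S] W VY by blast
  then have 1: "X \<oplus>\<^sub>o ?U \<in> S" using cl(3) dsum_assoc o W V by simp
  have "(Z \<oplus>\<^sub>o V) \<oplus>\<^sub>o (W \<oplus>\<^sub>o Y) \<in> S"
    using triangulated_subcategory_dsum[OF S] V VY by blast
  then have "(Z \<oplus>\<^sub>o W) \<oplus>\<^sub>o (V \<oplus>\<^sub>o Y) \<in> S" using cl(3) dsum_interchange o W V by simp
  then have 2: "Z \<oplus>\<^sub>o ?U \<in> S" using cl(3) dsum_assoc o W V by simp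
  show ?thesis unfolding stable_eq_def using o W V 1 2 by auto
qed

lemma iso_imp_stable_eq:
  assumes "X \<simeq> Y"
  shows "stable_eq S X Y"
proof -
  have o: "X \<in> Obj C" "Y \<in> Obj C" using isomorphic_obj[OF assms] by auto
  obtain W where W: "W \<in> Obj C" "X \<oplus>\<^sub>o W \<in> S" using o(1) by (rule dense_complement)
  have "Y \<oplus>\<^sub>o W \<in> S"
    using triangulated_subcategory_closed(3)[OF S W(2) dsum_cong[OF assms isomorphic_refl[OF W(1)]]] .
  then show ?thesis unfolding stable_eq_def using o W by blast
qed

lemma stable_eq_dsum:
  assumes "stable_eq S X X'" "stable_eq S Y Y'"
  shows "stable_eq S (X \<oplus>\<^sub>o Y) (X' \<oplus>\<^sub>o Y')"
proof -
  note cl = triangulated_subcategory_closed[OF S]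
  obtain W where W: "W \<in> Obj C" "X \<oplus>\<^sub>o W \<in> S" "X' \<oplus>\<^sub>o W \<in> S" "X \<in> Obj C" "X' \<in> Obj C"
    using assms unfolding stable_eq_def by blast
  obtain V where V: "V \<in> Obj C" "Y \<oplus>\<^sub>o V \<in> S" "Y' \<oplus>\<^sub>o V \<in> S" "Y \<in> Obj C" "Y' \<in> Obj C"
    using assms unfolding stable_eq_def by blast
  have "(X \<oplus>\<^sub>o W) \<oplus>\<^sub>o (Y \<oplus>\<^sub>o V) \<in> S" "(X' \<oplus>\<^sub>o W) \<oplus>\<^sub>o (Y' \<oplus>\<^sub>o V) \<in> S"
    using triangulated_subcategory_dsum[OF S] V W by auto
  then have "(X \<oplus>\<^sub>o Y) \<oplus>\<^sub>o (W \<oplus>\<^sub>o V) \<in> S" "(X' \<oplus>\<^sub>o Y') \<oplus>\<^sub>o (W \<oplus>\<^sub>o V) \<in> S"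
    using cl(3) dsum_interchange V W by simp_all
  then show ?thesis unfolding stable_eq_def using V W by auto
qed

text \<open>
  In general \<open>S\<close> is not closed under summands, but a summand in \<open>S\<close> can be cancelled: from
  \<open>Y \<oplus> W \<in> S\<close> and \<open>Y \<in> S\<close> the triangle \<open>W \<rightarrow> W \<oplus> Y \<rightarrow> Y\<close> yields \<open>W \<in> S\<close>, and in the same way
  \<open>X \<oplus> W \<in> S\<close> then yields \<open>X \<in> S\<close>.
\<close>

lemma stable_eq_mem:
  assumes "Y \<in> S"
  shows "stable_eq S Y X \<longleftrightarrow> X \<in> S"
proof
  note cl = triangulated_subcategory_closed[OF S]
  show "stable_eq S Y X" if "X \<in> S"
    unfolding stable_eq_def using that assms cl(1) triangulated_subcategory_dsum[OF S]
    by (blast intro: bexI[of _ Y])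
  show "X \<in> S" if e: "stable_eq S Y X"
  proof -
    obtain W where W: "W \<in> Obj C" "Y \<oplus>\<^sub>o W \<in> S" "X \<oplus>\<^sub>o W \<in> S" "X \<in> Obj C" "Y \<in> Obj C"
      using e unfolding stable_eq_def by blast
    have "W \<oplus>\<^sub>o Y \<in> S" using cl(3)[OF W(2) dsum_comm] W by blast
    then have "W \<in> S" using triangulated_subcategory_cancel[OF S] W assms by blast
    then show ?thesis using triangulated_subcategory_cancel[OF S] W by blast
  qed
qed

lemma stable_class_eq_iff:
  assumes "X \<in> Obj C" "Y \<in> Obj C"
  shows "stable_class S X = stable_class S Y \<longleftrightarrow> stable_eq S X Y"
  using assms stable_eq_refl stable_eq_sym stable_eq_trans unfolding stable_class_def by blast

lemma stable_class_eq_one: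
  assumes "X \<in> Obj C"
  shows "stable_class S X = S \<longleftrightarrow> X \<in> S"
proof
  show "X \<in> S" if "stable_class S X = S"
    using that stable_eq_refl[OF assms] unfolding stable_class_def by blast
  show "stable_class S X = S" if "X \<in> S"
    using stable_eq_mem[OF that] unfolding stable_class_def by blast
qed

lemma stable_class_mult:
  assumes "X \<in> Obj C" "Y \<in> Obj C"
  shows "stable_class S X \<otimes>\<^bsub>stable_group S\<^esub> stable_class S Y = stable_class S (X \<oplus>\<^sub>o Y)"
proof -
  have "(\<exists>X'. stable_eq S X X' \<and> (\<exists>Y'. stable_eq S Y Y' \<and> stable_eq S (X' \<oplus>\<^sub>o Y') W))
      \<longleftrightarrow> stable_eq S (X \<oplus>\<^sub>o Y) W" for W
    using stable_eq_dsum stable_eq_trans stable_eq_refl assms by blast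
  then show ?thesis unfolding stable_group_def stable_class_def by simp
qed

lemma stable_group_comm_group: "comm_group (stable_group S)"
proof -
  let ?G = "stable_group S"
  have car: "carrier ?G = stable_class S ` Obj C" and one: "\<one>\<^bsub>?G\<^esub> = S"
    unfolding stable_group_def by simp_all
  obtain N where N: "zero_object C N" using ex_zero_object by blast
  note No = zero_objectD(1)[OF N]
  have N_one: "stable_class S N = S"
    using stable_class_eq_one[OF No] triangulated_subcategory_zero[OF S N] by simp
  have iso: "stable_class S X = stable_class S Y" if "X \<simeq> Y" for X Y
    using stable_class_eq_iff iso_imp_stable_eq[OF that] isomorphic_obj[OF that] by blast
  show ?thesis
  proof (rule comm_groupI)
    show "U \<otimes>\<^bsub>?G\<^esub> V \<in> carrier ?G" if "U \<in> carrier ?G" "V \<in> carrier ?G" for U V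
      using that unfolding car by (auto simp: stable_class_mult)
    show "\<one>\<^bsub>?G\<^esub> \<in> carrier ?G" unfolding car one using N_one No by blast
    show "U \<otimes>\<^bsub>?G\<^esub> V \<otimes>\<^bsub>?G\<^esub> W = U \<otimes>\<^bsub>?G\<^esub> (V \<otimes>\<^bsub>?G\<^esub> W)"
      if "U \<in> carrier ?G" "V \<in> carrier ?G" "W \<in> carrier ?G" for U V W
      using that unfolding car by (auto simp: stable_class_mult iso[OF dsum_assoc])
    show "U \<otimes>\<^bsub>?G\<^esub> V = V \<otimes>\<^bsub>?G\<^esub> U" if "U \<in> carrier ?G" "V \<in> carrier ?G" for U V
      using that using iso[OF dsum_comm] unfolding car by (auto simp: stable_class_mult)
    show "\<one>\<^bsub>?G\<^esub> \<otimes>\<^bsub>?G\<^esub> U = U" if "U \<in> carrier ?G" for U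
    proof -
      obtain X where X: "X \<in> Obj C" "U = stable_class S X" using \<open>U \<in> carrier ?G\<close> unfolding car by blast
      have "N \<oplus>\<^sub>o X \<simeq> X"
        using dsum_comm[OF No X(1)] dsum_zero[OF X(1) N] by (rule isomorphic_trans)
      then have "stable_class S N \<otimes>\<^bsub>?G\<^esub> U = U" using X No iso by (simp add: stable_class_mult)
      then show ?thesis by (simp add: one N_one)
    qed
    show "\<exists>V \<in> carrier ?G. V \<otimes>\<^bsub>?G\<^esub> U = \<one>\<^bsub>?G\<^esub>" if "U \<in> carrier ?G" for U
    proof -
      obtain X where X: "X \<in> Obj C" "U = stable_class S X" using \<open>U \<in> carrier ?G\<close> unfolding car by blast
      obtain X' where X': "X' \<in> Obj C" "X \<oplus>\<^sub>o X' \<in> S" using X(1) by (rule dense_complement)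
      have "stable_class S X' \<otimes>\<^bsub>?G\<^esub> U = stable_class S (X \<oplus>\<^sub>o X')"
        using X X' iso[OF dsum_comm] by (simp add: stable_class_mult)
      also have "\<dots> = \<one>\<^bsub>?G\<^esub>"
        using X X' by (simp add: stable_class_eq_one one)
      finally show ?thesis unfolding car using X' by blast
    qed
  qed
qed

text \<open>
  If \<open>X'\<close> and \<open>Z'\<close> are complements of \<open>X\<close> and \<open>Z\<close>, then \<open>X' \<oplus> Z'\<close> is a complement of
  \<open>X \<oplus> Z\<close>.  It is also one of \<open>Y\<close>, since \<open>Y \<oplus> (X' \<oplus> Z')\<close> is an extension of \<open>Z \<oplus> Z'\<close> by
  \<open>X \<oplus> X'\<close>.
\<close>

lemma stable_class_tri:
  assumes t: "tri X Y Z"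
  shows "stable_class S Y = stable_class S X \<otimes>\<^bsub>stable_group S\<^esub> stable_class S Z"
proof -
  note o = tri_obj[OF t]
  obtain X' where X': "X' \<in> Obj C" "X \<oplus>\<^sub>o X' \<in> S" using o(1) by (rule dense_complement)
  obtain Z' where Z': "Z' \<in> Obj C" "Z \<oplus>\<^sub>o Z' \<in> S" using o(3) by (rule dense_complement)
  have "tri (X \<oplus>\<^sub>o X') (Y \<oplus>\<^sub>o (X' \<oplus>\<^sub>o Z')) (Z \<oplus>\<^sub>o Z')"
    by (rule tri_sum[OF t tri_dsum[OF X'(1) Z'(1)]])
  then have 1: "Y \<oplus>\<^sub>o (X' \<oplus>\<^sub>o Z') \<in> S"
    using triangulated_subcategory_middle[OF S] X' Z' by blast
  have "(X \<oplus>\<^sub>o X') \<oplus>\<^sub>o (Z \<oplus>\<^sub>o Z') \<in> S"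
    using triangulated_subcategory_dsum[OF S] X' Z' by blast
  then have "(X \<oplus>\<^sub>o Z) \<oplus>\<^sub>o (X' \<oplus>\<^sub>o Z') \<in> S"
    using triangulated_subcategory_closed(3)[OF S] dsum_interchange o X' Z' by simp
  then have "stable_eq S Y (X \<oplus>\<^sub>o Z)"
    unfolding stable_eq_def using 1 o X' Z' by auto
  then show ?thesis using o by (simp add: stable_class_mult stable_class_eq_iff)
qed

text \<open>
  The part of Thomason's theorem on dense triangulated subcategories that is needed.  The classes
  \<open>stable_class S X\<close> define a homomorphism on the Grothendieck group that kills the class of \<open>X\<close>
  exactly if \<open>X \<in> S\<close>.  Here it kills a set of generators, hence everything.
\<close>

theorem dense_eq_Obj_if_generates_K0:
  assumes G: "G \<subseteq> S" and gen: "generate (K0 C) (K0_class ` G) = carrier (K0 C)"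
  shows "S = Obj C"
proof
  show SO: "S \<subseteq> Obj C" by (rule triangulated_subcategory_closed(1)[OF S])
  interpret K: comm_group "K0 C" by (rule K0_comm_group)
  interpret A: comm_group "stable_group S" by (rule stable_group_comm_group)
  obtain \<Phi> where \<Phi>: "\<Phi> \<in> hom (K0 C) (stable_group S)"
    "\<And>X. X \<in> Obj C \<Longrightarrow> \<Phi> (K0_class X) = stable_class S X"
  proof (rule K0_universal[OF stable_group_comm_group, of "stable_class S"])
    show "stable_class S X \<in> carrier (stable_group S)" if "X \<in> Obj C" for X
      using that by (simp add: stable_group_def)
    show "stable_class S Y = stable_class S X \<otimes>\<^bsub>stable_group S\<^esub> stable_class S Z"
      if "tri X Y Z" for X Y Z
      by (rule stable_class_tri[OF that])
  qed (rule that)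
  interpret \<Phi>: group_hom "K0 C" "stable_group S" \<Phi> using \<Phi>(1) by unfold_locales
  have one: "\<one>\<^bsub>stable_group S\<^esub> = S" by (simp add: stable_group_def)
  have kernel_iff: "K0_class X \<in> kernel (K0 C) (stable_group S) \<Phi> \<longleftrightarrow> X \<in> S" if "X \<in> Obj C" for X
    using that K0_class_closed stable_class_eq_one \<Phi>(2) by (simp add: kernel_def one)
  then have "K0_class ` G \<subseteq> kernel (K0 C) (stable_group S) \<Phi>" using G SO by blast
  then have "carrier (K0 C) \<subseteq> kernel (K0 C) (stable_group S) \<Phi>"
    unfolding gen[symmetric] by (rule K.generate_subgroup_incl[OF _ \<Phi>.subgroup_kernel])
  then show "Obj C \<subseteq> S" using K0_class_closed kernel_iff by blast
qed

end

section \<open>Realising generators of the Grothendieck group\<close>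

lemma finite_common_sum:
  assumes "finite G" "G \<subseteq> Obj C"
  shows "\<exists>B \<in> Obj C. \<forall>X \<in> G. \<exists>X' \<in> Obj C. X \<oplus>\<^sub>o X' \<simeq> B"
  using assms
proof induction
  case empty
  then show ?case using ex_zero_object zero_objectD(1) by blast
next
  case (insert Y G)
  then obtain B where B: "B \<in> Obj C" "\<And>X. X \<in> G \<Longrightarrow> \<exists>X' \<in> Obj C. X \<oplus>\<^sub>o X' \<simeq> B" by auto
  have Y: "Y \<in> Obj C" using insert by simp
  have "\<exists>X' \<in> Obj C. X \<oplus>\<^sub>o X' \<simeq> B \<oplus>\<^sub>o Y" if X: "X \<in> insert Y G" for X
  proof (cases "X = Y")
    case True
    then show ?thesis using B(1) Y dsum_comm by blast
  next
    case False
    then obtain X' where X': "X' \<in> Obj C" "X \<oplus>\<^sub>o X' \<simeq> B" using B(2) X by blast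
    have Xo: "X \<in> Obj C" using X insert by blast
    have "X \<oplus>\<^sub>o (X' \<oplus>\<^sub>o Y) \<simeq> X \<oplus>\<^sub>o X' \<oplus>\<^sub>o Y"
      using Xo X' Y by (intro isomorphic_sym[OF dsum_assoc])
    also have "\<dots> \<simeq> B \<oplus>\<^sub>o Y" using X' Y by (intro dsum_cong isomorphic_refl)
    finally show ?thesis using X' Y by (intro bexI[of _ "X' \<oplus>\<^sub>o Y"]) simp_all
  qed
  then show ?case using B(1) Y by (intro bexI[of _ "B \<oplus>\<^sub>o Y"]) simp_all
qed

text \<open>
  Let \<open>B\<close> be an object that has every member of \<open>G\<close> as a direct summand.  The object
  \<open>B \<oplus> B[1]\<close> has class zero, so it can be added to any object of class \<open>a\<close> without changing
  the class.  The objects obtained in this way have all members of \<open>G\<close> as summands of theirs, which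
  makes their triangulated closure dense, and their classes generate.
\<close>

lemma K0_generators_lift:
  assumes G: "finite G" "generates C G"
    and A: "A \<subseteq> carrier (K0 C)" "A \<noteq> {}" "generate (K0 C) A = carrier (K0 C)"
  obtains Y where "generates C (Y ` A)"
proof -
  interpret K: comm_group "K0 C" by (rule K0_comm_group)
  have Go: "G \<subseteq> Obj C" "G \<noteq> {}" "triangulated_closure C G = Obj C"
    using G unfolding generates_def by auto
  obtain B where B: "B \<in> Obj C" "\<And>X. X \<in> G \<Longrightarrow> \<exists>X' \<in> Obj C. X \<oplus>\<^sub>o X' \<simeq> B"
    using finite_common_sum[OF G(1) Go(1)] by blast
  have "\<forall>a \<in> A. \<exists>X \<in> Obj C. K0_class X = a" using A(1) unfolding K0_carrier_eq by blast
  then obtain X where X: "\<And>a. a \<in> A \<Longrightarrow> X a \<in> Obj C" "\<And>a. a \<in> A \<Longrightarrow> K0_class (X a) = a"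
    by metis
  define D where "D = B \<oplus>\<^sub>o Shift C B"
  have D: "D \<in> Obj C" "K0_class D = \<one>\<^bsub>K0 C\<^esub>"
    unfolding D_def using B(1) K0_class_closed[OF B(1)] by (simp_all add: K0_class_dsum K0_class_shift)
  define Y where "Y a = X a \<oplus>\<^sub>o D" for a
  have Yo: "Y a \<in> Obj C" and YK: "K0_class (Y a) = a" if "a \<in> A" for a
    unfolding Y_def using X[OF that] D A(1) that by (auto simp: K0_class_dsum)
  have YO: "Y ` A \<subseteq> Obj C" "Y ` A \<noteq> {}" using Yo A(2) by auto
  let ?S = "triangulated_closure C (Y ` A)"
  note S = triangulated_closure[OF YO]
  note cl = triangulated_subcategory_closed[OF S(1)]
  have "G \<subseteq> summands ?S"
  proof
    fix Z assume Z: "Z \<in> G"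
    then obtain Z' where Z': "Z \<in> Obj C" "Z' \<in> Obj C" "Z \<oplus>\<^sub>o Z' \<simeq> B" using B(2) Go by blast
    obtain a where a: "a \<in> A" using A(2) by blast
    have "Y a \<simeq> D \<oplus>\<^sub>o X a" unfolding Y_def using X[OF a] D by (intro dsum_comm)
    also have "\<dots> \<simeq> B \<oplus>\<^sub>o (Shift C B \<oplus>\<^sub>o X a)"
      unfolding D_def using B(1) X[OF a] by (intro dsum_assoc) simp_all
    also have "\<dots> \<simeq> Z \<oplus>\<^sub>o Z' \<oplus>\<^sub>o (Shift C B \<oplus>\<^sub>o X a)"
      using B(1) X[OF a] by (intro dsum_cong isomorphic_sym[OF Z'(3)] isomorphic_refl) simp
    also have "\<dots> \<simeq> Z \<oplus>\<^sub>o (Z' \<oplus>\<^sub>o (Shift C B \<oplus>\<^sub>o X a))"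
      using Z' B(1) X[OF a] by (intro dsum_assoc) simp_all
    finally have "Z \<oplus>\<^sub>o (Z' \<oplus>\<^sub>o (Shift C B \<oplus>\<^sub>o X a)) \<in> ?S"
      using cl(3) S(2) a by blast
    then show "Z \<in> summands ?S" unfolding summands_def using Z' B(1) X[OF a] by auto
  qed
  then have "Obj C \<subseteq> summands ?S"
    using triangulated_closure(3)[OF Go(1,2) summands_triangulated[OF S(1)]] Go(3) by blast
  then have "summands ?S = Obj C" unfolding summands_def by blast
  moreover have "K0_class ` Y ` A = A" using YK by (force simp: image_image)
  ultimately have "?S = Obj C"
    using dense_eq_Obj_if_generates_K0[OF S(1) _ S(2)] A(3) by simp
  then show thesis using that YO unfolding generates_def by blast
qed

end

theorem proposition1p16:
  fixes C :: "('o, 'm, 'x) triangulated_category_scheme"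
  assumes "triangulated_category C"
    and "\<exists>G. finite G \<and> generates C G"
  shows "min_generators C = max (min_group_generators (K0 C)) 1"
proof -
  interpret triangulated_category C by fact
  interpret K: comm_group "K0 C" by (rule K0_comm_group)
  obtain G where G: "finite G" "generates C G" using assms(2) by blast
  let ?\<A> = "{A. finite A \<and> A \<subseteq> carrier (K0 C) \<and> generate (K0 C) A = carrier (K0 C)}"
  have classes: "K0_class ` F \<in> ?\<A>" if "finite F" "generates C F" for F
    using that generators_generate_K0[OF that(2)] K0_class_closed unfolding generates_def by auto
  show ?thesis
  proof (rule antisym)
    have "(INF A \<in> ?\<A>. enat (card A)) \<in> (\<lambda>A. enat (card A)) ` ?\<A>"
      by (rule wellorder_InfI, rule imageI, rule classes[OF G])
    then obtain A where A: "A \<in> ?\<A>" and min: "min_group_generators (K0 C) = enat (card A)"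
      unfolding min_group_generators_def by auto
    \<comment> \<open>a generating collection of objects is nonempty, also when the Grothendieck group is trivial and needs no generator; this accounts for the maximum with 1\<close>
    define A' where "A' = (if A = {} then {\<one>\<^bsub>K0 C\<^esub>} else A)"
    have A': "finite A'" "A' \<subseteq> carrier (K0 C)" "A' \<noteq> {}" "card A' \<le> max (card A) 1"
      using A by (auto simp: A'_def)
    have "generate (K0 C) A \<subseteq> generate (K0 C) A'"
      by (rule K.mono_generate) (auto simp: A'_def)
    then have "generate (K0 C) A' = carrier (K0 C)"
      using A K.generate_incl[OF A'(2)] by blast
    then obtain Y where Y: "generates C (Y ` A')"
      using K0_generators_lift[OF G A'(2,3)] by blast
    have "min_generators C \<le> enat (card (Y ` A'))"
      unfolding min_generators_def using Y A'(1) by (intro INF_lower) simp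
    also have "\<dots> \<le> enat (max (card A) 1)"
      using card_image_le[OF A'(1), of Y] A'(4) by simp
    also have "\<dots> = max (min_group_generators (K0 C)) 1"
      unfolding min by (simp add: one_enat_def)
    finally show "min_generators C \<le> max (min_group_generators (K0 C)) 1" .
  next
    have "max (min_group_generators (K0 C)) 1 \<le> enat (card F)" if F: "finite F" "generates C F" for F
    proof -
      have "min_group_generators (K0 C) \<le> enat (card (K0_class ` F))"
        unfolding min_group_generators_def using classes[OF F] by (rule INF_lower)
      also have "\<dots> \<le> enat (card F)" using card_image_le[OF F(1)] by simp
      finally have "min_group_generators (K0 C) \<le> enat (card F)" .
      moreover have "1 \<le> card F"
        using F unfolding generates_def by (simp add: Suc_le_eq card_gt_0_iff)
      ultimately show ?thesis by (simp add: one_enat_def)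
    qed
    then show "max (min_group_generators (K0 C)) 1 \<le> min_generators C"
      unfolding min_generators_def by (intro INF_greatest) simp
  qed
qed

end
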